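(* Let $n$ be a positive integer and let $G$ be a $K_4$-free graph on $n$ vertices. Then there exists a partition $V(G) = A \cup B$ with $A \cap B = \emptyset$, $|A| = \lfloor n/2 \rfloor$ and $|B| = \lceil n/2 \rceil$, such that $$e(G[A]) + e(G[B]) \le \frac{n^2}{9},$$ where $e(G[X])$ denotes the number of edges of $G$ with both endpoints in $X$. Equivalently, $G$ can be made a balanced bipartite graph (a bipartite graph whose two sides have sizes $\lfloor n/2\rfloor$ and $\lceil n/2\rceil$) by removing at most $n^2/9$ edges.
   Context: Graphs are finite, simple and undirected. A graph is $K_4$-free if it contains no complete graph on four vertices as a (not necessarily induced) subgraph. $G[X]$ denotes the subgraph of $G$ induced by the vertex set $X$. *)

theory Defs
  imports Complex_Main
begin

definition simple_graph :: "'a set \<Rightarrow> 'a set set \<Rightarrow> bool" where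
  "simple_graph V E \<longleftrightarrow> finite V \<and> (\<forall>e\<in>E. e \<subseteq> V \<and> card e = 2)"

definition K4_free :: "'a set \<Rightarrow> 'a set set \<Rightarrow> bool" where
  "K4_free V E \<longleftrightarrow> \<not> (\<exists>K. K \<subseteq> V \<and> card K = 4 \<and>
       (\<forall>u\<in>K. \<forall>v\<in>K. u \<noteq> v \<longrightarrow> {u, v} \<in> E))"

definition induced_edges :: "'a set set \<Rightarrow> 'a set \<Rightarrow> nat" where
  "induced_edges E X = card {e \<in> E. e \<subseteq> X}"

end

theory Submission
  imports Defs "HOL-Library.Multiset"
begin

text \<open>
  For \<open>s : V \<rightarrow> [-1,1]\<close> with \<open>\<Sum> s = 0\<close> put \<open>\<Phi> s = \<Sum>\<^bsub>u,v\<^esub> A\<^bsub>uv\<^esub> (1 + s\<^sub>u s\<^sub>v)\<close>. Moving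
  mass between two fractional vertices is a concave change of \<open>\<Phi>\<close>, so every such \<open>s\<close> can be rounded to
  the sign vector of an (almost) equipartition \<open>V = X \<union> Y\<close> without increasing \<open>\<Phi>\<close>, and then
  \<open>\<Phi> s = 4 (e(X) + e(Y))\<close>. In a counterexample therefore \<open>\<Phi> s > 4 n\<^sup>2 / 9\<close> for all balanced \<open>s\<close>.

  Two families of vectors are tested. If \<open>deg x \<le> n/2\<close>, let \<open>s\<close> be \<open>1\<close> on \<open>N(x)\<close> and constant off \<open>N(x)\<close>.
  If \<open>xy\<close> is an edge with \<open>deg x, deg y > n/2\<close>, let \<open>s\<close> be \<open>-1\<close> off \<open>N(x)\<close>, \<open>1\<close> on
  \<open>N(x) - N(y)\<close> and constant on the common neighbourhood, which is independent because the graph has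
  no \<open>K\<^sub>4\<close>. Each test gives an inequality between numbers of homomorphic copies of graphs on five vertices
  coloured ``high'' (degree above \<open>n/2\<close>) or ``low''. A flag algebra certificate shows that a positive
  combination of all these inequalities plus sums of squares is nonpositive on every coloured
  \<open>K\<^sub>4\<close>-free graph with five vertices. Summing over all 5-tuples of vertices, repetitions allowed, gives
  a contradiction for every \<open>n\<close>.
\<close>

section \<open>Rounding\<close>

text \<open>The bound is attained: in the complete tripartite graph with classes of size n/3, 6
  dividing n, no equipartition has fewer than n^2/9 inner edges. All degrees are 2n/3, so every
  vertex is high, and the test on an edge is an equality. Hence the certificate has no slack there:
  it is exactly 0 on every 5-tuple from this graph and all squares vanish on it, so an approximate
  solution would not do and the data are exact integers. The split into high and low comes from the
  range [-1,1]. A vector equal to 1 on N(x) can be balanced by a constant off N(x) only if deg x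
  \<le> n/2; for larger degree the excess has to be taken from inside N(x), and an edge xy shows
  where. Five vertices are what clearing denominators produces: (n - deg x)^2 in the low test, and
  only the first power of the codegree in the high test because the common neighbourhood is
  independent. A tuple with repetitions is an induced subgraph of a blow-up, where copies of a
  vertex are non-adjacent. Blow-ups stay free of K4, so summing over all tuples is exact and leaves
  no error term in n.\<close>

definition form :: "'v set \<Rightarrow> ('v \<Rightarrow> 'v \<Rightarrow> bool) \<Rightarrow> ('v \<Rightarrow> real) \<Rightarrow> ('v \<Rightarrow> real) \<Rightarrow> real" where
  "form V A f g = (\<Sum>u\<in>V. \<Sum>v\<in>V. of_bool (A u v) * f u * g v)"

lemma form_commute:
  assumes "\<And>u v. A u v = A v u"
  shows "form V A f g = form V A g f"
proof -
  have "form V A f g = (\<Sum>v\<in>V. \<Sum>u\<in>V. of_bool (A u v) * f u * g v)"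
    unfolding form_def by (rule sum.swap)
  then show ?thesis
    by (simp add: form_def assms mult_ac)
qed

lemma form_add_left: "form V A (\<lambda>v. f v + c * f' v) g = form V A f g + c * form V A f' g"
  by (simp add: form_def algebra_simps sum.distrib sum_distrib_left)

lemma form_add_square:
  assumes "\<And>u v. A u v = A v u"
  shows "form V A (\<lambda>v. f v + c * g v) (\<lambda>v. f v + c * g v) =
    form V A f f + 2 * c * form V A g f + c\<^sup>2 * form V A g g"
proof -
  have r: "form V A k (\<lambda>v. f v + c * g v) = form V A k f + c * form V A k g" for k
    using form_commute[OF assms, where f = k and g = "\<lambda>v. f v + c * g v"]
      form_commute[OF assms, where f = k and g = f] form_commute[OF assms, where f = k and g = g]
    by (simp add: form_add_left)
  show ?thesis
    by (simp add: form_add_left r form_commute[OF assms, where f = f and g = g] power2_eq_square algebra_simps)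
qed

lemma form_point:
  assumes "finite V" "u \<in> V"
  shows "form V A (\<lambda>w. of_bool (w = u)) g = (\<Sum>v\<in>V. of_bool (A u v) * g v)"
proof -
  have "form V A (\<lambda>w. of_bool (w = u)) g = (\<Sum>w\<in>V. of_bool (w = u) * (\<Sum>v\<in>V. of_bool (A w v) * g v))"
    by (simp add: form_def sum_distrib_left mult_ac)
  also have "\<dots> = (\<Sum>w\<in>V. if w = u then \<Sum>v\<in>V. of_bool (A u v) * g v else 0)"
    by (rule sum.cong) auto
  finally show ?thesis
    using assms by simp
qed

section \<open>Rounding balanced vectors to equipartitions\<close>

definition balanced :: "'v set \<Rightarrow> ('v \<Rightarrow> real) \<Rightarrow> bool" where
  "balanced V s \<longleftrightarrow> (\<forall>v\<in>V. \<bar>s v\<bar> \<le> 1) \<and> sum s V = 0"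

definition fractional :: "'v set \<Rightarrow> ('v \<Rightarrow> real) \<Rightarrow> 'v set" where
  "fractional V s = {v \<in> V. \<bar>s v\<bar> < 1}"

text \<open>The move is t (e_u - e_v). Its second-order coefficient is -2 \<open>A u v\<close>, as
  there are no loops, and \<open>le\<close> makes the derivative at t = 0 nonpositive. Going to the
  end of the admissible segment therefore cannot increase the form.\<close>

lemma balanced_shift:
  fixes V :: "'v set"
  assumes V: "finite V" and sym: "\<And>u v. A u v = A v u" and irrefl: "\<And>v. \<not> A v v"
    and s: "balanced V s" and uv: "u \<in> fractional V s" "v \<in> fractional V s" "u \<noteq> v"
    and le: "form V A (\<lambda>w. of_bool (w = u)) s \<le> form V A (\<lambda>w. of_bool (w = v)) s"
  obtains s' where "balanced V s'" "form V A s' s' \<le> form V A s s" "fractional V s' \<subset> fractional V s"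
proof -
  \<comment> \<open>The largest t that keeps both changed entries in [-1,1], so that one of the two
    vertices stops being fractional.\<close>
  define t where "t = min (1 - s u) (1 + s v)"
  define e where "e = (\<lambda>(x :: 'v) w. of_bool (w = x) :: real)"
  define d where "d = (\<lambda>w. e u w + (-1) * e v w)"
  define s' where "s' = (\<lambda>w. s w + t * d w)"
  have u: "u \<in> V" "\<bar>s u\<bar> < 1" and v: "v \<in> V" "\<bar>s v\<bar> < 1"
    using uv by (auto simp: fractional_def)
  have t: "0 < t"
    using u v by (auto simp: t_def)
  have s'u: "s' u = s u + t" and s'v: "s' v = s v - t" and s'w: "w \<noteq> u \<Longrightarrow> w \<noteq> v \<Longrightarrow> s' w = s w" for w
    using uv(3) by (auto simp: s'_def d_def e_def)
  have "\<bar>s' w\<bar> \<le> 1" if "w \<in> V" for w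
  proof -
    consider "w = u" | "w = v" | "w \<noteq> u" "w \<noteq> v" by blast
    then show ?thesis
    proof cases
      case 3
      then show ?thesis using s that by (simp add: s'w balanced_def)
    qed (use u v t in \<open>auto simp: s'u s'v t_def abs_le_iff abs_less_iff\<close>)
  qed
  moreover have "sum s' V = 0"
    using s V u v by (simp add: s'_def d_def e_def sum.distrib balanced_def sum_subtractf flip: sum_distrib_left)
  moreover have "form V A s' s' \<le> form V A s s"
  proof -
    have pt: "form V A (e x) (e y) = of_bool (A x y)" if "x \<in> V" "y \<in> V" for x y
      unfolding e_def form_point[OF V that(1)]
      using V that by (simp add: of_bool_def if_distrib[of "\<lambda>x. _ * x"] cong: if_cong)
    have "form V A s' s' = form V A s s + 2 * t * form V A d s + t\<^sup>2 * form V A d d"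
      unfolding s'_def by (rule form_add_square[OF sym])
    moreover have "form V A d s \<le> 0"
      unfolding d_def form_add_left using le by (simp add: e_def)
    moreover have "form V A d d \<le> 0"
      unfolding d_def form_add_square[OF sym] using u v irrefl by (simp add: pt)
    ultimately show ?thesis
      using t by (simp add: mult_nonneg_nonpos add_nonpos_nonpos)
  qed
  moreover have "fractional V s' \<subset> fractional V s"
  proof -
    have "s' u = 1 \<or> s' v = -1"
      by (auto simp: s'u s'v t_def min_def)
    then have "u \<notin> fractional V s' \<or> v \<notin> fractional V s'"
      by (auto simp: fractional_def)
    moreover have "fractional V s' \<subseteq> fractional V s"
      using u v s'w by (force simp: fractional_def)
    ultimately show ?thesis
      using uv by blast
  qed
  ultimately show ?thesis
    using that[of s'] unfolding balanced_def by blast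
qed

definition sign :: "'v set \<Rightarrow> 'v \<Rightarrow> real" where
  "sign X v = (if v \<in> X then 1 else -1)"

lemma form_cong:
  assumes "\<And>v. v \<in> V \<Longrightarrow> f v = f' v" "\<And>v. v \<in> V \<Longrightarrow> g v = g' v"
  shows "form V A f g = form V A f' g'"
  unfolding form_def using assms by (intro sum.cong refl) auto

text \<open>Two fractional vertices allow a shift, which makes the fractional set smaller. In the
  end at most one is left, and it is left exactly when the order is odd.\<close>

lemma balanced_rounding:
  assumes V: "finite V" and sym: "\<And>u v. A u v = A v u" and irrefl: "\<And>v. \<not> A v v"
    and "balanced V s"
  shows "\<exists>X\<subseteq>V. card X = card V div 2 \<and> form V A (sign X) (sign X) \<le> form V A s s"
  using assms(4)
proof (induction "card (fractional V s)" arbitrary: s rule: less_induct)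
  case less
  have finite: "finite (fractional V s)"
    using V by (simp add: fractional_def)
  show ?case
  proof (cases "\<exists>u v. u \<in> fractional V s \<and> v \<in> fractional V s \<and> u \<noteq> v")
    case True
    \<comment> \<open>One of the two directions along the pair has nonpositive derivative; the names
      are chosen accordingly.\<close>
    then obtain u v where "u \<in> fractional V s" "v \<in> fractional V s" "u \<noteq> v"
      "form V A (\<lambda>w. of_bool (w = u)) s \<le> form V A (\<lambda>w. of_bool (w = v)) s"
      by (metis linear)
    then obtain s' where s': "balanced V s'" "form V A s' s' \<le> form V A s s" "fractional V s' \<subset> fractional V s"
      by (rule balanced_shift[OF V sym irrefl less.prems])
    then show ?thesis
      using less.hyps[of s'] psubset_card_mono[OF finite] by (meson order.trans)
  next
    case False
    define P where "P = {v \<in> V. s v = 1}"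
    define M where "M = {v \<in> V. s v = -1}"
    have V_eq: "V = P \<union> M \<union> fractional V s"
      using less.prems by (fastforce simp: P_def M_def fractional_def balanced_def abs_if split: if_splits)
    have disj: "P \<inter> M = {}" "(P \<union> M) \<inter> fractional V s = {}"
      by (auto simp: P_def M_def fractional_def)
    have fin: "finite P" "finite M"
      using V by (simp_all add: P_def M_def)
    have "sum s V = sum s P + sum s M + sum s (fractional V s)"
      by (subst V_eq) (simp add: sum.union_disjoint fin finite disj)
    moreover have "sum s P = real (card P)" "sum s M = - real (card M)"
      by (simp_all add: P_def M_def)
    ultimately have sum: "real (card P) - real (card M) + sum s (fractional V s) = 0"
      using less.prems by (simp add: balanced_def)
    have card: "card V = card P + card M + card (fractional V s)"
      by (subst V_eq) (simp add: card_Un_disjoint fin finite disj)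
    show ?thesis
    proof (cases "fractional V s = {}")
      case True
      then have "card P = card V div 2"
        using sum card by simp
      moreover have "form V A (sign P) (sign P) = form V A s s"
        using V_eq True by (intro form_cong) (auto simp: sign_def P_def M_def)
      ultimately show ?thesis
        by (intro exI[of _ P]) (auto simp: P_def)
    next
      case False': False
      then obtain w where w: "fractional V s = {w}"
        using False by blast
      then have "w \<in> V" "\<bar>s w\<bar> < 1"
        by (auto simp: fractional_def)
      \<comment> \<open>An integer of absolute value below 1: the remaining fractional entry is 0
        and both signs are equally frequent.\<close>
      have "real_of_int (int (card M) - int (card P)) = s w"
        using sum w by simp
      moreover from this \<open>\<bar>s w\<bar> < 1\<close> have "int (card M) - int (card P) = 0"
        by linarith
      ultimately have eq: "card M = card P" "s w = 0"
        by simp_all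
      then have half: "card P = card V div 2" "card M = card V div 2"
        using card w by simp_all
      \<comment> \<open>Without loops the form is affine in the entry at \<open>w\<close>. Its
        values for the entries 1 and -1 average to the value for 0, so one of them is not
        larger.\<close>
      define e where "e = (\<lambda>v. of_bool (v = w) :: real)"
      have "form V A e e = 0"
        unfolding e_def form_point[OF V \<open>w \<in> V\<close>] using V \<open>w \<in> V\<close> irrefl
        by (simp add: of_bool_def if_distrib[of "\<lambda>x. _ * x"] cong: if_cong)
      then have shift: "form V A (\<lambda>v. s v + c * e v) (\<lambda>v. s v + c * e v) = form V A s s + 2 * c * form V A e s" for c
        by (simp add: form_add_square[OF sym])
      have P: "form V A (sign P) (sign P) = form V A s s + 2 * (-1) * form V A e s"
        unfolding shift[symmetric]
        using V_eq w eq by (intro form_cong) (auto simp: sign_def P_def M_def e_def)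
      \<comment> \<open>Giving \<open>w\<close> the entry 1 makes the positive side one vertex too
        large. The same cut is described by \<open>M\<close>, which has the right size, and the
        global change of sign is invisible to the quadratic form.\<close>
      have M: "form V A (sign M) (sign M) = form V A s s + 2 * 1 * form V A e s"
      proof -
        have "form V A (sign M) (sign M) = form V A (\<lambda>v. - sign M v) (\<lambda>v. - sign M v)"
          by (simp add: form_def)
        also have "\<dots> = form V A s s + 2 * 1 * form V A e s"
          unfolding shift[symmetric]
          using V_eq w eq by (intro form_cong) (auto simp: sign_def P_def M_def e_def)
        finally show ?thesis .
      qed
      consider "form V A (sign P) (sign P) \<le> form V A s s" | "form V A (sign M) (sign M) \<le> form V A s s"
        using P M by linarith
      moreover have "P \<subseteq> V" "M \<subseteq> V"
        by (auto simp: P_def M_def)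
      ultimately show ?thesis
        using half by metis
    qed
  qed
qed

section \<open>The test vectors\<close>

text \<open>A counterexample, seen analytically. The constant in \<open>cut\<close> is 4 times 1/9
  because the right-hand side at a sign vector is four times the number of inner edges; rounding
  extends the bound to all balanced vectors.\<close>

locale no_good_cut =
  fixes V :: "'v set" and A :: "'v \<Rightarrow> 'v \<Rightarrow> bool" and n :: real
  assumes finite: "finite V" and n: "n = real (card V)" "0 < n"
    and sym: "\<And>u v. A u v = A v u" and irrefl: "\<And>v. \<not> A v v"
    and no_K4: "\<And>w x y z. \<lbrakk>w \<in> V; x \<in> V; y \<in> V; z \<in> V; A w x; A w y; A w z; A x y; A x z; A y z\<rbrakk> \<Longrightarrow> False"
    and cut: "\<And>s. balanced V s \<Longrightarrow> 4 / 9 * n\<^sup>2 < form V A (\<lambda>_. 1) (\<lambda>_. 1) + form V A s s"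
begin

definition m :: real where
  "m = form V A (\<lambda>_. 1) (\<lambda>_. 1)"

definition a :: "'v \<Rightarrow> 'v \<Rightarrow> real" where
  "a u v = of_bool (A u v)"

definition deg :: "'v \<Rightarrow> real" where
  "deg x = (\<Sum>v\<in>V. a x v)"

text \<open>Walks of length two starting at \<open>x\<close>, that is, the degree sum over N(x).
  Likewise \<open>T x\<close> counts ordered adjacent pairs inside N(x) and \<open>m\<close> all
  ordered adjacent pairs.\<close>

definition D :: "'v \<Rightarrow> real" where
  "D x = form V A (a x) (\<lambda>_. 1)"

definition T :: "'v \<Rightarrow> real" where
  "T x = form V A (a x) (a x)"

lemma deg_nonneg: "0 \<le> deg x"
  by (simp add: deg_def a_def sum_nonneg)

lemma form_affine_square:
  "form V A (\<lambda>v. c * a x v + e) (\<lambda>v. c * a x v + e) = c\<^sup>2 * T x + 2 * c * e * D x + e\<^sup>2 * m"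
proof -
  have "form V A (\<lambda>v. e + c * a x v) (\<lambda>v. e + c * a x v) =
      form V A (\<lambda>_. e) (\<lambda>_. e) + 2 * c * form V A (a x) (\<lambda>_. e) + c\<^sup>2 * T x"
    unfolding T_def by (rule form_add_square[OF sym])
  moreover have "form V A (\<lambda>_. e) (\<lambda>_. e) = e\<^sup>2 * m"
    unfolding form_def m_def sum_distrib_left
    by (intro sum.cong refl) (simp add: power2_eq_square)
  moreover have "form V A (a x) (\<lambda>_. e) = e * D x"
    unfolding form_def D_def sum_distrib_left by (intro sum.cong refl) simp
  ultimately show ?thesis
    by (simp add: add.commute)
qed

text \<open>The test vector is 1 on N(x) and -deg x / (n - deg x) elsewhere; deg x \<le> n/2 says
  that the second value is at least -1. It is affine in \<open>a x\<close>, so its square involves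
  only \<open>m\<close>, \<open>D x\<close> and \<open>T x\<close>. Multiplying by 9 (n - deg x)^2
  makes all terms homogeneous: sums over four vertices besides \<open>x\<close>.\<close>

lemma low_pos:
  assumes "x \<in> V" "deg x \<le> n / 2"
  shows "0 < (9 * m - 4 * n\<^sup>2) * (n - deg x)\<^sup>2 + 9 * n\<^sup>2 * T x - 18 * n * deg x * D x + 9 * (deg x)\<^sup>2 * m"
proof -
  define k where "k = n - deg x"
  have k: "0 < k" "deg x \<le> k"
    using assms(2) n(2) by (simp_all add: k_def)
  define s where "s = (\<lambda>v. (n / k) * a x v + (- deg x / k))"
  have "n / k - deg x / k = 1"
    using k(1) by (simp add: k_def flip: diff_divide_distrib)
  then have "s v = (if A x v then 1 else - deg x / k)" for v
    by (simp add: s_def a_def)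
  then have "\<bar>s v\<bar> \<le> 1" for v
    using k deg_nonneg[of x] by simp
  moreover have "sum s V = (n / k) * deg x + n * (- deg x / k)"
    unfolding s_def sum.distrib by (simp add: deg_def n(1) sum_distrib_left)
  ultimately have "balanced V s"
    by (simp add: balanced_def)
  from cut[OF this] have "4 / 9 * n\<^sup>2 < m + ((n / k)\<^sup>2 * T x + 2 * (n / k) * (- deg x / k) * D x + (- deg x / k)\<^sup>2 * m)"
    unfolding s_def form_affine_square m_def[symmetric] .
  then have "4 / 9 * n\<^sup>2 * k\<^sup>2 < (m + ((n / k)\<^sup>2 * T x + 2 * (n / k) * (- deg x / k) * D x + (- deg x / k)\<^sup>2 * m)) * k\<^sup>2"
    using k by (intro mult_strict_right_mono) auto
  also have "\<dots> = m * k\<^sup>2 + n\<^sup>2 * T x - 2 * n * deg x * D x + (deg x)\<^sup>2 * m"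
    using k by (simp add: field_simps power2_eq_square)
  finally show ?thesis
    unfolding k_def[symmetric] by (simp add: algebra_simps)
qed

text \<open>Start from 2 \<open>a x\<close> - 1, whose sum is k = 2 deg x - n > 0, and lower it by
  k/c on the c common neighbours. By inclusion-exclusion c \<ge> deg x + deg y - n > k/2, so the
  lowered entries 1 - k/c are still at least -1.\<close>

lemma high_pos:
  assumes xy: "x \<in> V" "y \<in> V" "A x y" and deg: "n / 2 < deg x" "n / 2 < deg y"
  defines "p \<equiv> \<lambda>v. a x v * a y v"
  shows "0 < sum p V * (18 * m - 4 * n\<^sup>2 - 36 * D x + 36 * T x)
    + 18 * (2 * deg x - n) * form V A p (\<lambda>v. 1 - 2 * a x v)"
proof -
  define c where "c = sum p V"
  define k where "k = 2 * deg x - n"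
  have "a x v + a y v - 1 \<le> p v" for v
    by (simp add: p_def a_def)
  then have "(\<Sum>v\<in>V. a x v + a y v - 1) \<le> c"
    unfolding c_def by (intro sum_mono) simp
  then have c: "deg x + deg y - n \<le> c"
    by (simp add: sum.distrib sum_subtractf deg_def n(1))
  have k: "0 < k" and ck: "k \<le> 2 * c" "0 < c"
    using c deg by (simp_all add: k_def)
  \<comment> \<open>An edge inside the common neighbourhood would form a K4 with \<open>x\<close>
    and \<open>y\<close>. Without this term k/c enters only linearly, and a single factor c clears
    the denominators.\<close>
  have pp: "form V A p p = 0"
    unfolding form_def
  proof (intro sum.neutral ballI)
    fix u v assume "u \<in> V" "v \<in> V"
    then show "of_bool (A u v) * p u * p v = 0"
      using no_K4[OF xy(1,2) \<open>u \<in> V\<close> \<open>v \<in> V\<close>] xy(3) by (auto simp: p_def a_def)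
  qed
  define s where "s = (\<lambda>v. (2 * a x v + (- 1)) + (- (k / c)) * p v)"
  have "0 \<le> k / c" "k / c \<le> 2"
    using k ck by (simp_all add: field_simps)
  then have "\<bar>s v\<bar> \<le> 1" for v
    by (cases "A x v"; cases "A y v") (simp_all add: s_def p_def a_def abs_le_iff)
  moreover have "sum s V = 2 * deg x - n + (- (k / c)) * c"
    by (simp add: s_def sum.distrib sum_subtractf c_def deg_def n(1) flip: sum_distrib_left sum_divide_distrib)
  ultimately have "balanced V s"
    using ck by (simp add: balanced_def k_def)
  from cut[OF this] have "4 / 9 * n\<^sup>2 < m + (4 * T x - 4 * D x + m - 2 * (k / c) * form V A p (\<lambda>v. 2 * a x v + (- 1)))"
    unfolding s_def form_add_square[OF sym] form_affine_square pp m_def[symmetric] by simp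
  then have "4 / 9 * n\<^sup>2 * (9 * c) <
      (m + (4 * T x - 4 * D x + m - 2 * (k / c) * form V A p (\<lambda>v. 2 * a x v + (- 1)))) * (9 * c)"
    using ck by (intro mult_strict_right_mono) auto
  also have "\<dots> = c * (18 * m + 36 * T x - 36 * D x) - 18 * k * form V A p (\<lambda>v. 2 * a x v + (- 1))"
    using ck by (simp add: field_simps)
  also have "form V A p (\<lambda>v. 2 * a x v + (- 1)) = - form V A p (\<lambda>v. 1 - 2 * a x v)"
    by (simp add: form_def algebra_simps flip: sum_negf)
  finally show ?thesis
    unfolding c_def[symmetric] k_def[symmetric] by (simp add: algebra_simps)
qed

end

section \<open>The certificate\<close>

abbreviation (input) ite :: "bool \<Rightarrow> 'a \<Rightarrow> 'a \<Rightarrow> 'a" where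
  "ite b x y \<equiv> (if b then x else y)"

text \<open>
  The weights and linear forms are a rounded solution of a semidefinite program. The constructor
  \<open>Rij\<close> of \<open>root3\<close> stands for three root vertices whose edges (12, 13, 23) and high colours (1, 2, 3)
  are the binary digits, lowest first, of \<open>i\<close> and \<open>j\<close>, and \<open>R\<close> for all root types
  without a square. The binary digits, lowest first, of the index in \<open>ext3\<close> and \<open>ext2\<close> are the adjacencies of a further vertex to the roots, then its colour. The
  constructors of \<open>ext1\<close> enumerate unordered pairs of further vertices over a single low root. The
  \<open>gram\<close> tables are the sums of squares multiplied out, so that checking a five-vertex graph
  only takes lookups and additions.
\<close>

datatype ext3 = E0 | E1 | E2 | E3 | E4 | E5 | E6 | E7 | E8 | E9 | E10 | E11 | E12 | E13 | E14 | E15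

datatype ext2 = D0 | D1 | D2 | D3 | D4 | D5 | D6 | D7

datatype ext1 = P0 | P1 | P2 | P3 | P4 | P5 | P6 | P7 | P8 | P9 | P10 | P11 | P12 | P13 | P14 | P15 | P16 | P17 | P18 | P19

datatype root3 = R | R10 | R11 | R13 | R17 | R23 | R30 | R33 | R37 | R41 | R51 | R63 | R73 | R77

section \<open>Flags and the Gram tables of the squares\<close>

definition ext3 :: "bool \<Rightarrow> bool \<Rightarrow> bool \<Rightarrow> bool \<Rightarrow> ext3" where
  "ext3 a b c d =
  (ite a (ite b (ite c (ite d E15 E7) (ite d E11 E3)) (ite c (ite d E13 E5) (ite d E9 E1))) (ite b (ite c (ite d
  E14 E6) (ite d E10 E2)) (ite c (ite d E12 E4) (ite d E8 E0))))"

definition ext2 :: "bool \<Rightarrow> bool \<Rightarrow> bool \<Rightarrow> ext2" where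
  "ext2 a b c =
  (ite a (ite b (ite c D7 D3) (ite c D5 D1)) (ite b (ite c D6 D2) (ite c D4 D0)))"

definition ext1 :: "bool \<Rightarrow> bool \<Rightarrow> bool \<Rightarrow> bool \<Rightarrow> bool \<Rightarrow> ext1" where
  "ext1 a b c d e =
  (ite a (ite b (ite c (ite d (ite e P19 P13) (ite e P13 P5)) (ite d (ite e P16 P9) (ite e P9 P2))) (ite c (ite d
  (ite e P18 P11) (ite e P12 P4)) (ite d (ite e P15 P7) (ite e P8 P1)))) (ite b (ite c (ite d (ite e P18 P12)
  (ite e P11 P4)) (ite d (ite e P15 P8) (ite e P7 P1))) (ite c (ite d (ite e P17 P10) (ite e P10 P3)) (ite d
  (ite e P14 P6) (ite e P6 P0)))))"

text \<open>Sums run over all ordered root triples, so one labelling per isomorphism class is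
  enough; the chosen one puts the high roots first. The other labellings fall into \<open>R\<close>,
  as do all edgeless types.\<close>

definition root3 :: "bool \<Rightarrow> bool \<Rightarrow> bool \<Rightarrow> bool \<Rightarrow> bool \<Rightarrow> bool \<Rightarrow> root3" where
  "root3 a b c d e f =
  ite a (ite b (ite c (ite d (ite e (ite f R77 R37) (ite f R R17)) R) (ite d (ite e (ite f R73 R33) (ite f R
  R13)) (ite e (ite f R63 R23) R))) (ite c R (ite d (ite e R (ite f R51 R11)) (ite e R (ite f R41 R))))) (ite b
  R (ite c R (ite d (ite e (ite f R R30) (ite f R R10)) R)))"

primrec weights3 :: "root3 \<Rightarrow> int list" where
  "weights3 R = []"
| "weights3 R10 = [23458, 103658, 96004, 502060, 1233348]"
| "weights3 R11 = [60558, 299014, 1072262, 1902426, 5038462]"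
| "weights3 R13 = [956386, 4037244, 12990314, 41699506, 53199744, 349331676]"
| "weights3 R17 = [1328476, 1440790, 3573098, 21246326, 43069740, 79791208, 408209874, 44841826, 9756548]"
| "weights3 R23 = [62636, 266996, 990316, 2386744, 3464492, 16146902]"
| "weights3 R30 = [202, 58596, 66918, 193302]"
| "weights3 R33 = [2078, 202216, 567254, 560408, 3334664]"
| "weights3 R37 = [1248, 65168, 138452, 146422, 981534, 9194992]"
| "weights3 R41 = [390, 1606, 5600, 13122, 26290, 179802]"
| "weights3 R51 = [66, 126, 7866, 24960, 32540, 151116, 157538]"
| "weights3 R63 = [96, 334, 5592, 9302, 28704, 124160]"
| "weights3 R73 = [214, 198, 1882, 10452, 63688, 86450, 151378]"
| "weights3 R77 = [7676, 7514, 24496, 144422, 29840, 30167034]"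

definition weights_L :: "int list" where
  "weights_L = [78672, 96536, 304686, 220990, 1026294]"

primrec forms_L :: "ext1 \<Rightarrow> int list" where
  "forms_L P0 = [-30, -74, -42, 191, -1]"
| "forms_L P1 = [13, 153, 28, 107, -7]"
| "forms_L P2 = [-4, 2, 27, 123, -48]"
| "forms_L P3 = [4, -139, -19, -173, -35]"
| "forms_L P4 = [61, -40, 92, -189, -21]"
| "forms_L P5 = [-79, 62, -200, 23, 178]"
| "forms_L P6 = [-28, -99, -13, 196, 22]"
| "forms_L P7 = [2, 200, 52, 105, -1]"
| "forms_L P8 = [27, 9, 60, 59, -47]"
| "forms_L P9 = [-4, 2, -25, 130, -52]"
| "forms_L P10 = [50, -16, -56, -125, 18]"
| "forms_L P11 = [-44, 26, -30, -157, -31]"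
| "forms_L P12 = [-28, -13, 42, -200, -47]"
| "forms_L P13 = [-18, -112, 6, -87, 179]"
| "forms_L P14 = [-17, -104, 33, 170, 37]"
| "forms_L P15 = [-92, -12, 67, 45, -23]"
| "forms_L P16 = [105, -92, -72, 128, -91]"
| "forms_L P17 = [200, 60, -146, -41, 6]"
| "forms_L P18 = [-91, 89, -40, -180, -33]"
| "forms_L P19 = [103, 27, 173, 10, 200]"

primrec gram_L :: "ext1 \<Rightarrow> ext1 \<Rightarrow> int" where
  "gram_L P0 = case_ext1 9199864524 3041583280 4890619570 (-6039584196) (-8991495740) 3091036610
  9190068944 2334093400 1642746112 5855622600 (-4581697446) (-6292995880) (-8772096174) (-3090105080)
  7498341402 1368486096 6826927026 (-769047742) (-7472907554) (-2432991784)"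
| "gram_L P1 = case_ext1 3041583280 5092383532 3509075862 (-6050336980) (-4061757840) (-1606203182)
  2874779900 5889676596 2405177020 3259710788 (-3747985270) (-3406621628) (-4253871250) (-4964605188)
  2482060474 1529559312 1814727886 (-1167396166) (-3138980070) 779678708"
| "gram_L P2 = case_ext1 4890619570 3509075862 5931700076 (-3162671968) (-3372929002) (-9751948810)
  4126612806 3369112130 4405876086 5891241770 (-4763948050) (-2968341934) (-2769219484) (-11149332586)
  3054948190 2934019632 7319004304 (-2662450734) (-3550309768) (-8184616314)"
| "gram_L P3 = case_ext1 (-6039584196) (-6050336980) (-3162671968) 9847642314 8003381120 (-6972131630)
  (-6888697226) (-6962464252) (-1027003300) (-2985579930) 4686959898 6926782024 9256997490
  (-1641137560) (-6629230032) (-1150035006) 59498886 1454986654 7075676066 (-8897760326)"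
| "gram_L P4 = case_ext1 (-8991495740) (-4061757840) (-3372929002) 8003381120 11372637860
  (-11021682550) (-8776995060) (-3669066568) 325379232 (-5036707900) 3564939986 6073067216 10459507826
  290185520 (-6652805546) 99094572 (-4544035670) (-1781291886) 6327680630 511313772"
| "gram_L P5 = case_ext1 3091036610 (-1606203182) (-9751948810) (-6972131630) (-11021682550)
  45683519142 5388858320 (-1633107658) (-12056264462) (-7278356348) 5658864814 (-4203889278)
  (-12065677556) 31333480838 5095507952 (-7555750074) (-12789062836) 8900615942 (-3407602900)
  25566205700"
| "gram_L P6 = case_ext1 9190068944 2874779900 4126612806 (-6888697226) (-8776995060) 5388858320
  10045598254 2403609564 1111195676 4545464950 (-4743258944) (-7532969008) (-9704433872) 1359500640
  9099462350 1481789370 4422696836 (-2076097844) (-9033302364) 3778664410"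
| "gram_L P7 = case_ext1 2334093400 5889676596 3369112130 (-6962464252) (-3669066568) (-1633107658)
  2403609564 7123066676 2545902276 2711774012 (-4107260674) (-3591451132) (-4182519190) (-4272626836)
  2418916150 1883146488 163012690 (-2080795026) (-3072567682) 3305236788"
| "gram_L P8 = case_ext1 1642746112 2405177020 4405876086 (-1027003300) 325379232 (-12056264462)
  1111195676 2545902276 4198390540 3739467908 (-3429484918) (-1171027724) 356439422 (-9794409012)
  908614570 2715142848 4885235710 (-3016080838) (-1602349974) (-6111893740)"
| "gram_L P9 = case_ext1 5855622600 3259710788 5891241770 (-2985579930) (-5036707900) (-7278356348)
  4545464950 2711774012 3739467908 6701903622 (-4143961836) (-2608639328) (-3551096436) (-12113804032)
  2643193602 2036524506 9031326744 (-437329808) (-3059539480) (-11731137470)"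
| "gram_L P10 = case_ext1 (-4581697446) (-3747985270) (-4763948050) 4686959898 3564939986 5658864814
  (-4743258944) (-4107260674) (-3429484918) (-4143961836) 4962376518 4062891802 3849822492 5709798734
  (-4481820720) (-3154492626) (-3433286628) 4428571678 4549728140 830080180"
| "gram_L P11 = case_ext1 (-6292995880) (-3406621628) (-2968341934) 6926782024 6073067216 (-4203889278)
  (-7532969008) (-3591451132) (-1171027724) (-2608639328) 4062891802 6925235772 8114786734
  (-2950051084) (-7579208146) (-1153620564) (-1482096658) 2024429186 8199086354 (-8580070672)"
| "gram_L P12 = case_ext1 (-8772096174) (-4253871250) (-2769219484) 9256997490 10459507826
  (-12065677556) (-9704433872) (-4182519190) 356439422 (-3551096436) 3849822492 8114786734 11722142982
  (-4531997446) (-8708125926) 195618906 (-2305093650) (-861492740) 9124313618 (-8136069308)"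
| "gram_L P13 = case_ext1 (-3090105080) (-4964605188) (-11149332586) (-1641137560) 290185520
  31333480838 1359500640 (-4272626836) (-9794409012) (-12113804032) 5709798734 (-2950051084)
  (-4531997446) 35803565372 4737555850 (-4707919260) (-18463855094) 691665030 (-3508146010)
  36427545216"
| "gram_L P14 = case_ext1 7498341402 2482060474 3054948190 (-6629230032) (-6652805546) 5095507952
  9099462350 2418916150 908614570 2643193602 (-4481820720) (-7579208146) (-8708125926) 4737555850
  9190280124 1734377988 1412503494 (-3650309620) (-9189416126) 9300883214"
| "gram_L P15 = case_ext1 1368486096 1529559312 2934019632 (-1150035006) 99094572 (-7555750074)
  1481789370 1883146488 2715142848 2036524506 (-3154492626) (-1153620564) 195618906 (-4707919260)
  1734377988 3037930722 1297734702 (-5046864294) (-1272078798) (-1866665010)"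
| "gram_L P16 = case_ext1 6826927026 1814727886 7319004304 59498886 (-4544035670) (-12789062836)
  4422696836 163012690 4885235710 9031326744 (-3433286628) (-1482096658) (-2305093650) (-18463855094)
  1412503494 1297734702 15383372502 2601980468 (-2674300766) (-21579810160)"
| "gram_L P17 = case_ext1 (-769047742) (-1167396166) (-2662450734) 1454986654 (-1781291886) 8900615942
  (-2076097844) (-2080795026) (-3016080838) (-437329808) 4428571678 2024429186 (-861492740) 691665030
  (-3650309620) (-5046864294) 2601980468 10397527150 2290738068 (-4777780568)"
| "gram_L P18 = case_ext1 (-7472907554) (-3138980070) (-3550309768) 7075676066 6327680630 (-3407602900)
  (-9033302364) (-3072567682) (-1602349974) (-3059539480) 4549728140 8199086354 9124313618
  (-3508146010) (-9189416126) (-1272078798) (-2674300766) 2290738068 10181352254 (-9785166168)"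
| "gram_L P19 = case_ext1 (-2432991784) 779678708 (-8184616314) (-8897760326) 511313772 25566205700
  3778664410 3305236788 (-6111893740) (-11731137470) 830080180 (-8580070672) (-8136069308) 36427545216
  9300883214 (-1866665010) (-21579810160) (-4777780568) (-9785166168) 51097812286"

definition weights_HL :: "int list" where
  "weights_HL = [114, 800, 4118, 73028]"

primrec forms_HL :: "ext2 \<Rightarrow> int list" where
  "forms_HL D0 = [-89, -373, 871, -157]"
| "forms_HL D1 = [-51, -448, -385, 137]"
| "forms_HL D2 = [-607, -12, 1000, 471]"
| "forms_HL D3 = [-331, 282, -396, -809]"
| "forms_HL D4 = [673, 427, 904, 177]"
| "forms_HL D5 = [1000, -254, -356, 527]"
| "forms_HL D6 = [-120, 1000, -288, 500]"
| "forms_HL D7 = [575, 205, 430, -1000]"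

primrec gram_HL :: "ext2 \<Rightarrow> ext2 \<Rightarrow> int" where
  "gram_HL D0 = case_ext2 5036357004 (-2817468136) (-1803684094) 7774350802 1078827162 (-7253509060)
  (-7062872544) 12940704590"
| "gram_HL D1 = case_ext2 (-2817468136) 2141912796 3134677654 (-7565226410) 180677630 5922181252
  5101319520 (-10763385950)"
| "gram_HL D2 = case_ext2 (-1803684094) 3134677654 20360722934 (-29437046754) 9760127822 16594023476
  16010813760 (-32667204850)"
| "gram_HL D3 = case_ext2 7774350802 (-7565226410) (-29437046754) 48517315910 (-11860340298)
  (-30649473836) (-28840048256) 58402989910"
| "gram_HL D4 = case_ext2 1078827162 180677630 9760127822 (-11860340298) 5850686806 5476663180
  5723241824 (-11211063890)"
| "gram_HL D5 = case_ext2 (-7253509060) 5922181252 16594023476 (-30649473836) 5476663180 20969505060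
  19448208304 (-39092245440)"
| "gram_HL D6 = case_ext2 (-7062872544) 5101319520 16010813760 (-28840048256) 5723241824 19448208304
  19400204992 (-36867839120)"
| "gram_HL D7 = case_ext2 12940704590 (-10763385950) (-32667204850) 58402989910 (-11211063890)
  (-39092245440) (-36867839120) 73860729450"

definition weights_HH :: "int list" where
  "weights_HH = [524, 33716, 71376, 11427600, 9967344]"

text \<open>In the balanced complete tripartite graph a further vertex over a high edge is of kind
  \<open>D5\<close>, \<open>D6\<close> or \<open>D7\<close>, each for a third of the vertices. These
  three rows add up to zero, so the squares vanish on that graph, as they must.\<close>

primrec forms_HH :: "ext2 \<Rightarrow> int list" where
  "forms_HH D0 = [-178, 900, -241, 0, 0]"
| "forms_HH D1 = [304, -39, 99, 0, 0]"
| "forms_HH D2 = [-674, -95, -364, 0, 0]"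
| "forms_HH D3 = [-23, -136, 669, 0, 0]"
| "forms_HH D4 = [-89, 1000, 62, 1, 0]"
| "forms_HH D5 = [1000, 121, -247, -1, 1]"
| "forms_HH D6 = [-542, -209, -753, 0, 0]"
| "forms_HH D7 = [-458, 88, 1000, 1, -1]"

primrec gram_HH :: "ext2 \<Rightarrow> ext2 \<Rightarrow> int" where
  "gram_HH D0 = case_ext2 31472151872 (-2914746272) 3441535552 (-15632574248) 29286201016 7827199552
  6661390672 (-14488590224)"
| "gram_HH D1 = case_ext2 (-2914746272) 799264196 (-2554553260) 4902469712 (-890995456) (-1745167132)
  (-5132385988) 6877553120"
| "gram_HH D2 = case_ext2 3441535552 (-2554553260) 9999362020 (-16937464248) (-4782400904) 5676531988
  20424443164 (-26100975152)"
| "gram_HH D3 = case_ext2 (-15632574248) 4902469712 (-16937464248) 32569002268 (-1623769644)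
  (-12361266864) (-34991283864) 47352550728"
| "gram_HH D4 = case_ext2 29286201016 (-890995456) (-4782400904) (-1623769644) 34005947548 2928520336
  (-10353627224) 7425106888"
| "gram_HH D5 = case_ext2 7827199552 (-1745167132) 5676531988 (-12361266864) 2928520336 5393609284
  12138641692 (-17532250976)"
| "gram_HH D6 = case_ext2 6661390672 (-5132385988) 20424443164 (-34991283864) (-10353627224)
  12138641692 42097515316 (-54236157008)"
| "gram_HH D7 = case_ext2 (-14488590224) 6877553120 (-26100975152) 47352550728 7425106888
  (-17532250976) (-54236157008) 71768407984"

text \<open>Interchanging the first two roots is an automorphism of the type; it swaps
  \<open>E1\<close> with \<open>E2\<close>, \<open>E5\<close> with \<open>E6\<close>, and so on.
  Every coordinate is even or odd under it, here only the third is odd, which splits the Gram matrix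
  into two blocks. The tables for \<open>R13\<close>, \<open>R63\<close> and \<open>R73\<close> have
  the same symmetry.\<close>

primrec forms_R10 :: "ext3 \<Rightarrow> int list" where
  "forms_R10 E0 = [160, -300, 0, 89, -41]"
| "forms_R10 E1 = [-63, -17, -287, 90, -92]"
| "forms_R10 E2 = [-63, -17, 287, 90, -92]"
| "forms_R10 E3 = [-136, -121, 0, -233, 246]"
| "forms_R10 E4 = [36, 227, 0, -68, -66]"
| "forms_R10 E5 = [86, -90, -300, -78, -38]"
| "forms_R10 E6 = [86, -90, 300, -78, -38]"
| "forms_R10 E7 = [104, -7, 0, 300, 300]"
| "forms_R10 E8 = [-300, -207, 0, 169, -59]"
| "forms_R10 E9 = [28, 8, -141, 137, -24]"
| "forms_R10 E10 = [28, 8, 141, 137, -24]"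
| "forms_R10 E11 = [4, -113, 0, -96, 194]"
| "forms_R10 E12 = [-21, 186, 0, -44, -8]"
| "forms_R10 E13 = [1, 77, -74, 52, -25]"
| "forms_R10 E14 = [1, 77, 74, 52, -25]"
| "forms_R10 E15 = [-76, 274, 0, 99, 145]"

primrec gram_R10 :: "ext3 \<Rightarrow> ext3 \<Rightarrow> int" where
  "gram_R10 E0 = case_ext3 15979820048 8965888416 8965888416 (-19598426828) (-6625019152) 1557803744
  1557803744 (-1157155480) 15846131072 7191544652 7191544652 (-10570631312) (-7424464096) 1196968860
  1196968860 (-11714540080)"
| "gram_R10 E1 = case_ext3 8965888416 22536558912 6721051960 (-38027117486) 3963062890 9084769104
  (-7447119696) (-20626146314) 15139074246 12743148652 4973160916 (-26157377902) (-1377145134)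
  7088107976 3010242072 (-12350029780)"
| "gram_R10 E2 = case_ext3 8965888416 6721051960 22536558912 (-38027117486) 3963062890 (-7447119696)
  9084769104 (-20626146314) 15139074246 4973160916 12743148652 (-26157377902) (-1377145134) 3010242072
  7088107976 (-12350029780)"
| "gram_R10 E3 = case_ext3 (-19598426828) (-38027117486) (-38027117486) 103845158854 (-15032024142)
  (-1550427812) (-1550427812) 55683096774 (-34117021166) (-23497612860) (-23497612860) 71494932714
  453959356 (-14637021034) (-14637021034) 29218289696"
| "gram_R10 E4 = case_ext3 (-6625019152) 3963062890 3963062890 (-15032024142) 13065783978 3711056052
  3711056052 (-34739200210) (-6091148570) (-2511679136) (-2511679136) (-15169893518) 6512285092
  2072422710 2072422710 (-8799869084)"
| "gram_R10 E5 = case_ext3 1557803744 9084769104 (-7447119696) (-1550427812) 3711056052 14488972720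
  (-2791747280) (-25533258308) (-2527056564) (-197377480) (-8319315880) (-4270544764) 320407644
  550281488 (-3712296112) (-13382182568)"
| "gram_R10 E6 = case_ext3 1557803744 (-7447119696) 9084769104 (-1550427812) 3711056052 (-2791747280)
  14488972720 (-25533258308) (-2527056564) (-8319315880) (-197377480) (-4270544764) 320407644
  (-3712296112) 550281488 (-13382182568)"
| "gram_R10 E7 = case_ext3 (-1157155480) (-20626146314) (-20626146314) 55683096774 (-34739200210)
  (-25533258308) (-25533258308) 156445520970 3042493242 11817065248 11817065248 57413277606
  (-9773422188) (-1471406030) (-1471406030) 68177591924"
| "gram_R10 E8 = case_ext3 15846131072 15139074246 15139074246 (-34117021166) (-6091148570)
  (-2527056564) (-2527056564) 3042493242 25185481690 13001911100 13001911100 (-19865807970)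
  (-6994432820) 4572049318 4572049318 (-7495758324)"
| "gram_R10 E9 = case_ext3 7191544652 12743148652 4973160916 (-23497612860) (-2511679136) (-197377480)
  (-8319315880) 11817065248 13001911100 12067253296 8249942248 (-12436640944) (-2649165064) 5382900128
  3379488656 2694688452"
| "gram_R10 E10 = case_ext3 7191544652 4973160916 12743148652 (-23497612860) (-2511679136)
  (-8319315880) (-197377480) 11817065248 13001911100 8249942248 12067253296 (-12436640944)
  (-2649165064) 3379488656 5382900128 2694688452"
| "gram_R10 E11 = case_ext3 (-10570631312) (-26157377902) (-26157377902) 71494932714 (-15169893518)
  (-4270544764) (-4270544764) 57413277606 (-19865807970) (-12436640944) (-12436640944) 52369254618
  (-1974108972) (-9389855746) (-9389855746) 26705910772"
| "gram_R10 E12 = case_ext3 (-7424464096) (-1377145134) (-1377145134) 453959356 6512285092 320407644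
  320407644 (-9773422188) (-6994432820) (-2649165064) (-2649165064) (-1974108972) 4647419578 582053578
  582053578 1702608240"
| "gram_R10 E13 = case_ext3 1196968860 7088107976 3010242072 (-14637021034) 2072422710 550281488
  (-3712296112) (-1471406030) 4572049318 5382900128 3379488656 (-9389855746) 582053578 3268742384
  2217306576 298912056"
| "gram_R10 E14 = case_ext3 1196968860 3010242072 7088107976 (-14637021034) 2072422710 (-3712296112)
  550281488 (-1471406030) 4572049318 3379488656 5382900128 (-9389855746) 582053578 2217306576
  3268742384 298912056"
| "gram_R10 E15 = case_ext3 (-11714540080) (-12350029780) (-12350029780) 29218289696 (-8799869084)
  (-13382182568) (-13382182568) 68177591924 (-7495758324) 2694688452 2694688452 26705910772 1702608240
  298912056 298912056 38769553176"

primrec forms_R11 :: "ext3 \<Rightarrow> int list" where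
  "forms_R11 E0 = [-117, -197, 118, -13, -6]"
| "forms_R11 E1 = [60, -74, 101, 8, -66]"
| "forms_R11 E2 = [2, -171, -200, -76, -36]"
| "forms_R11 E3 = [24, 60, -3, -61, 200]"
| "forms_R11 E4 = [-175, 63, 22, -20, -32]"
| "forms_R11 E5 = [25, 158, 74, 39, -59]"
| "forms_R11 E6 = [-24, 124, -136, -100, -26]"
| "forms_R11 E7 = [-106, -31, -44, 183, 117]"
| "forms_R11 E8 = [200, -200, 98, -16, 22]"
| "forms_R11 E9 = [158, 94, 32, 86, -99]"
| "forms_R11 E10 = [20, -67, -91, 5, -51]"
| "forms_R11 E11 = [180, 65, 10, -47, 164]"
| "forms_R11 E12 = [-192, 42, 12, 12, 5]"
| "forms_R11 E13 = [125, 114, -7, 42, -51]"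
| "forms_R11 E14 = [114, -27, -146, 18, -38]"
| "forms_R11 E15 = [25, -54, -100, 200, 36]"

primrec gram_R11 :: "ext3 \<Rightarrow> ext3 \<Rightarrow> int" where
  "gram_R11 E0 = case_ext3 27866483502 18510506096 (-12278764474) (-8621503674) 1774469912 697835436
  (-21082773832) (-11052937268) 22494359792 (-1741820968) (-6290857608) (-7634420912) (-43276248)
  (-7983560798) (-16986595222) (-15683528210)"
| "gram_R11 E1 = case_ext3 18510506096 34862849862 (-7053991580) (-69001396314) 10689547480 24822179440
  (-10435486824) (-40586194992) 8205995124 36189879036 8735581102 (-54952871184) (-1807441692)
  14772291890 (-1889516720) (-18471653368)"
| "gram_R11 E2 = case_ext3 (-12278764474) (-7053991580) 69152449934 (-29878899120) 735569822
  (-18882307328) 41996764792 (-36672802234) (-12442945088) (-6126869276) 31471088470 (-28397877706)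
  (-7386137292) (-1134600176) 36994502510 (-11237358776)"
| "gram_R11 E3 = case_ext3 (-8621503674) (-69001396314) (-29878899120) 209738389312 (-29120037052)
  (-61346777698) (-11967938152) 96094542354 20413265948 (-107928536652) (-52852793244) 172111406242
  4081748752 (-54016880550) (-40230240184) 12456537240"
| "gram_R11 E4 = case_ext3 1774469912 10689547480 735569822 (-29120037052) 9480705612 12485810618
  7378885448 (-26325453946) (-6513610456) 13540879552 4411767766 (-25100785166) 1846280852 7282416094
  281035974 (-17055175502)"
| "gram_R11 E5 = case_ext3 697835436 24822179440 (-18882307328) (-61346777698) 12485810618 33806617126
  (-4659757972) (-26319223168) (-9097045876) 43029669790 5176009716 (-48102446510) 2049736238
  23296558148 (-55987216) (-6310847986)"
| "gram_R11 E6 = case_ext3 (-21082773832) (-10435486824) 41996764792 (-11967938152) 7378885448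
  (-4659757972) 46895338936 (-44720331660) (-21835452200) (-4802675388) 16486825972 (-11852433808)
  (-2851526668) 3756792740 21677682368 (-30220289776)"
| "gram_R11 E7 = case_ext3 (-11052937268) (-40586194992) (-36672802234) 96094542354 (-26325453946)
  (-26319223168) (-44720331660) 135725532006 3345161316 (-31815422034) (-23537776798) 78085487700
  7402233618 (-16971308798) (-9727707874) 95908817080"
| "gram_R11 E8 = case_ext3 22494359792 8205995124 (-12442945088) 20413265948 (-6513610456)
  (-9097045876) (-21835452200) 3345161316 27606520912 (-13936725180) (-11118761360) 18953118008
  (-3387199660) (-12970725568) (-17106579616) (-9073327696)"
| "gram_R11 E9 = case_ext3 (-1741820968) 36189879036 (-6126869276) (-107928536652) 13540879552
  43029669790 (-4802675388) (-31815422034) (-13936725180) 68704162662 21442983982 (-85601706024)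
  (-775566666) 36470825186 17221914592 10054819268"
| "gram_R11 E10 = case_ext3 (-6290857608) 8735581102 31471088470 (-52852793244) 4411767766 5176009716
  16486825972 (-23537776798) (-11118761360) 21442983982 23398498980 (-44648721868) (-3415540470)
  12055106084 24860819194 3521505620"
| "gram_R11 E11 = case_ext3 (-7634420912) (-54952871184) (-28397877706) 172111406242 (-25100785166)
  (-48102446510) (-11852433808) 78085487700 18953118008 (-85601706024) (-44648721868) 143049572536
  1910665756 (-42393894692) (-33856769510) 10014985108"
| "gram_R11 E12 = case_ext3 (-43276248) (-1807441692) (-7386137292) 4081748752 1846280852 2049736238
  (-2851526668) 7402233618 (-3387199660) (-775566666) (-3415540470) 1910665756 3314187430 (-437768082)
  (-4089562168) 3217189008"
| "gram_R11 E13 = case_ext3 (-7983560798) 14772291890 (-1134600176) (-54016880550) 7282416094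
  23296558148 3756792740 (-16971308798) (-12970725568) 36470825186 12055106084 (-42393894692)
  (-437768082) 21345664658 12241211584 5828859134"
| "gram_R11 E14 = case_ext3 (-16986595222) (-1889516720) 36994502510 (-40230240184) 281035974
  (-55987216) 21677682368 (-9727707874) (-17106579616) 17221914592 24860819194 (-33856769510)
  (-4089562168) 12241211584 31753254918 16219695496"
| "gram_R11 E15 = case_ext3 (-15683528210) (-18471653368) (-11237358776) 12456537240 (-17055175502)
  (-6310847986) (-30220289776) 95908817080 (-9073327696) 10054819268 3521505620 10014985108 3217189008
  5828859134 16219695496 94259280326"

primrec forms_R13 :: "ext3 \<Rightarrow> int list" where
  "forms_R13 E0 = [25, 0, 4, -25, 0, -1]"
| "forms_R13 E1 = [-25, -10, 7, 2, -25, 1]"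
| "forms_R13 E2 = [-25, 10, 7, 2, 25, 1]"
| "forms_R13 E3 = [9, 0, -12, 3, 0, 21]"
| "forms_R13 E4 = [14, 0, 8, 6, 0, -12]"
| "forms_R13 E5 = [4, -17, -3, 8, -21, -5]"
| "forms_R13 E6 = [4, 17, -3, 8, 21, -5]"
| "forms_R13 E7 = [8, 0, -20, -10, 0, 7]"
| "forms_R13 E8 = [12, 0, 21, -15, 0, -1]"
| "forms_R13 E9 = [-12, 14, 11, -6, -16, -4]"
| "forms_R13 E10 = [-12, -14, 11, -6, 16, -4]"
| "forms_R13 E11 = [3, 0, 11, 4, 0, 25]"
| "forms_R13 E12 = [-18, 0, -25, -15, 0, -10]"
| "forms_R13 E13 = [15, 25, -3, 13, -16, -7]"
| "forms_R13 E14 = [15, -25, -3, 13, 16, -7]"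
| "forms_R13 E15 = [-23, 0, -3, -2, 0, 5]"

primrec gram_R13 :: "ext3 \<Rightarrow> ext3 \<Rightarrow> int" where
  "gram_R13 E0 = case_ext3 27217109200 (-2668319434) (-2668319434) (-10871776368) (-1312520640)
  (-6653487988) (-6653487988) 7131606848 17364748602 7936910620 7936910620 (-12259939734) 17401226410
  (-10904256736) (-10904256736) (-367488798)"
| "gram_R13 E1 = case_ext3 (-2668319434) 35403960736 (-31903168064) 6279789006 (-3298863556)
  27168295602 (-30064098558) (-398589548) 22343502 20104132642 (-21325234238) 9995413176 (-6587233190)
  18278010680 (-22263162520) 1856985712"
| "gram_R13 E2 = case_ext3 (-2668319434) (-31903168064) 35403960736 6279789006 (-3298863556)
  (-30064098558) 27168295602 (-398589548) 22343502 (-21325234238) 20104132642 9995413176 (-6587233190)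
  (-22263162520) 18278010680 1856985712"
| "gram_R13 E3 = case_ext3 (-10871776368) 6279789006 6279789006 156378637152 (-88407556752)
  (-35176956636) (-35176956636) 53287306344 (-12382712406) (-31912463028) (-31912463028) 182210624946
  (-71493970062) (-49128712224) (-49128712224) 36699308346"
| "gram_R13 E4 = case_ext3 (-1312520640) (-3298863556) (-3298863556) (-88407556752) 52823775312
  22703266928 22703266928 (-33817166152) 2782070172 16249213016 16249213016 (-102615398812)
  35327773508 32485495776 32485495776 (-22080018460)"
| "gram_R13 E5 = case_ext3 (-6653487988) 27168295602 (-30064098558) (-35176956636) 22703266928
  36162125906 (-13093575334) (-14752545948) (-4029765594) 21424720254 (-12403779570) (-42749279038)
  13368056838 32896938554 578367986 (-9371558682)"
| "gram_R13 E6 = case_ext3 (-6653487988) (-30064098558) 27168295602 (-35176956636) 22703266928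
  (-13093575334) 36162125906 (-14752545948) (-4029765594) (-12403779570) 21424720254 (-42749279038)
  13368056838 578367986 32896938554 (-9371558682)"
| "gram_R13 E7 = case_ext3 7131606848 (-398589548) (-398589548) 53287306344 (-33817166152)
  (-14752545948) (-14752545948) 26544537028 (-1554514656) (-10228998704) (-10228998704) 56630147244
  (-11840854004) (-21644002744) (-21644002744) 13664042596"
| "gram_R13 E8 = case_ext3 17364748602 22343502 22343502 (-12382712406) 2782070172 (-4029765594)
  (-4029765594) (-1554514656) 15598168584 8013325194 8013325194 (-8200069830) 5849211384 (-6332322240)
  (-6332322240) (-1578025518)"
| "gram_R13 E9 = case_ext3 7936910620 20104132642 (-21325234238) (-31912463028) 16249213016 21424720254
  (-12403779570) (-10228998704) 8013325194 23210470898 (-5610397678) (-34396557646) 14360465606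
  20960065482 (-9104274246) (-6650957274)"
| "gram_R13 E10 = case_ext3 7936910620 (-21325234238) 20104132642 (-31912463028) 16249213016
  (-12403779570) 21424720254 (-10228998704) 8013325194 (-5610397678) 23210470898 (-34396557646)
  14360465606 (-9104274246) 20960065482 (-6650957274)"
| "gram_R13 E11 = case_ext3 (-12259939734) 9995413176 9995413176 182210624946 (-102615398812)
  (-42749279038) (-42749279038) 56630147244 (-8200069830) (-34396557646) (-34396557646) 220579925064
  (-93458870554) (-59350311980) (-59350311980) 42838192456"
| "gram_R13 E12 = case_ext3 17401226410 (-6587233190) (-6587233190) (-71493970062) 35327773508
  13368056838 13368056838 (-11840854004) 5849211384 14360465606 14360465606 (-93458870554) 52744371764
  17037862980 17037862980 (-14845381266)"
| "gram_R13 E13 = case_ext3 (-10904256736) 18278010680 (-22263162520) (-49128712224) 32485495776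
  32896938554 578367986 (-21644002744) (-6332322240) 20960065482 (-9104274246) (-59350311980)
  17037862980 40638980278 8354156350 (-13523836160)"
| "gram_R13 E14 = case_ext3 (-10904256736) (-22263162520) 18278010680 (-49128712224) 32485495776
  578367986 32896938554 (-21644002744) (-6332322240) (-9104274246) 20960065482 (-59350311980)
  17037862980 8354156350 40638980278 (-13523836160)"
| "gram_R13 E15 = case_ext3 (-367488798) 1856985712 1856985712 36699308346 (-22080018460) (-9371558682)
  (-9371558682) 13664042596 (-1578025518) (-6650957274) (-6650957274) 42838192456 (-14845381266)
  (-13523836160) (-13523836160) 9522930944"

text \<open>This type does not occur in the balanced complete tripartite graph, but it does after
  deleting the edge between roots 1 and 3, or 2 and 3. The further vertices are then of kinds
  \<open>E9\<close>, \<open>E14\<close>, \<open>E15\<close>, or \<open>E10\<close>,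
  \<open>E13\<close>, \<open>E15\<close>, up to the ends of the deleted edge. The rows of either
  triple add up to zero.\<close>

primrec forms_R17 :: "ext3 \<Rightarrow> int list" where
  "forms_R17 E0 = [-25, -1, 0, -13, 6, 25, 1, 0, 0]"
| "forms_R17 E1 = [1, 25, 25, -8, -12, -3, -2, 0, 0]"
| "forms_R17 E2 = [1, 25, -25, -8, -12, -3, -2, 0, 0]"
| "forms_R17 E3 = [-3, -25, 0, 5, 1, -6, 23, 0, 0]"
| "forms_R17 E4 = [1, 24, 0, 11, 3, 9, -9, 0, 0]"
| "forms_R17 E5 = [-7, -4, 15, 7, 5, -6, -4, 0, 0]"
| "forms_R17 E6 = [-7, -4, -15, 7, 5, -6, -4, 0, 0]"
| "forms_R17 E7 = [6, 10, 0, 5, -8, 11, 5, 0, 0]"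
| "forms_R17 E8 = [25, -13, 0, -3, 9, 19, 1, 0, 0]"
| "forms_R17 E9 = [1, -10, 9, -25, -7, -3, -2, 1, 1]"
| "forms_R17 E10 = [1, -10, -9, -25, -7, -3, -2, -1, 0]"
| "forms_R17 E11 = [-3, 24, 0, 2, 4, -3, 25, 0, 0]"
| "forms_R17 E12 = [-5, -20, 0, 23, -25, 5, -10, 0, 0]"
| "forms_R17 E13 = [-2, 5, 9, 7, 14, -4, -10, 0, 0]"
| "forms_R17 E14 = [-2, 5, -9, 7, 14, -4, -10, -2, -1]"
| "forms_R17 E15 = [1, 5, 0, 18, -7, 7, 12, 1, 0]"

primrec gram_R17 :: "ext3 \<Rightarrow> ext3 \<Rightarrow> int" where
  "gram_R17 E0 = case_ext3 56250592898 (-7761395374) (-7761395374) (-3566791398) 11948372776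
  (-14004597702) (-14004597702) 20321593560 40651839118 (-1723437478) (-1723437478) 4767232274
  (-6726434914) (-10317557196) (-10317557196) 12040994674"
| "gram_R17 E1 = case_ext3 (-7761395374) 13047776268 8581403768 (-19612581558) 2639030264 2114475498
  (-565348002) (-3062198248) (-9941183550) 10663161754 9055267654 (-21239172992) 15251889996
  1677570248 69676148 (-10732837902)"
| "gram_R17 E2 = case_ext3 (-7761395374) 8581403768 13047776268 (-19612581558) 2639030264 (-565348002)
  2114475498 (-3062198248) (-9941183550) 9055267654 10663161754 (-21239172992) 15251889996 69676148
  1677570248 (-10732837902)"
| "gram_R17 E3 = case_ext3 (-3566791398) (-19612581558) (-19612581558) 220302184758 (-88378871428)
  (-33551877814) (-33551877814) 41480405944 730183210 (-19942479318) (-19942479318) 235689143798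
  (-94175101130) (-90798812152) (-90798812152) 110741291470"
| "gram_R17 E4 = case_ext3 11948372776 2639030264 2639030264 (-88378871428) 43317744264 12521228262
  12521228262 (-9981480112) 10015847344 (-1898250198) (-1898250198) (-92191418602) 41776361418
  37481539202 37481539202 (-35583289004)"
| "gram_R17 E5 = case_ext3 (-14004597702) 2114475498 (-565348002) (-33551877814) 12521228262
  12413749960 10805855860 (-14523012990) (-9394633974) 7073284 (-957663176) (-38336320136) 12133359566
  22771486820 21806750360 (-21813823644)"
| "gram_R17 E6 = case_ext3 (-14004597702) (-565348002) 2114475498 (-33551877814) 12521228262
  10805855860 12413749960 (-14523012990) (-9394633974) (-957663176) 7073284 (-38336320136) 12133359566
  21806750360 22771486820 (-21813823644)"
| "gram_R17 E7 = case_ext3 20321593560 (-3062198248) (-3062198248) 41480405944 (-9981480112)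
  (-14523012990) (-14523012990) 23339508664 15309664372 (-7095202058) (-7095202058) 47549232998
  (-5292714050) (-27945398534) (-27945398534) 35040600592"
| "gram_R17 E8 = case_ext3 40651839118 (-9941183550) (-9941183550) 730183210 10015847344 (-9394633974)
  (-9394633974) 15309664372 33966492846 (-6263923174) (-6263923174) 6531018498 (-7450076074)
  (-5325691304) (-5325691304) 11589614478"
| "gram_R17 E9 = case_ext3 (-1723437478) 10663161754 9055267654 (-19942479318) (-1898250198) 7073284
  (-957663176) (-7095202058) (-6263923174) 18229758166 17551476090 (-22310416876) 2569412030
  1397474892 719192816 (-18948950982)"
| "gram_R17 E10 = case_ext3 (-1723437478) 9055267654 10663161754 (-19942479318) (-1898250198)
  (-957663176) 7073284 (-7095202058) (-6263923174) 17551476090 18220001618 (-22310416876) 2569412030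
  818633016 1487158544 (-19038634634)"
| "gram_R17 E11 = case_ext3 4767232274 (-21239172992) (-21239172992) 235689143798 (-92191418602)
  (-38336320136) (-38336320136) 47549232998 6531018498 (-22310416876) (-22310416876) 257465244590
  (-107250631684) (-98204754344) (-98204754344) 120515171220"
| "gram_R17 E12 = case_ext3 (-6726434914) 15251889996 15251889996 (-94175101130) 41776361418
  12133359566 12133359566 (-5292714050) (-7450076074) 2569412030 2569412030 (-107250631684)
  81583189454 27440618486 27440618486 (-30010030516)"
| "gram_R17 E13 = case_ext3 (-10317557196) 1677570248 69676148 (-90798812152) 37481539202 22771486820
  21806750360 (-27945398534) (-5325691304) 1397474892 818633016 (-98204754344) 27440618486 51911140334
  51332298458 (-52729773350)"
| "gram_R17 E14 = case_ext3 (-10317557196) 69676148 1677570248 (-90798812152) 37481539202 21806750360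
  22771486820 (-27945398534) (-5325691304) 719192816 1487158544 (-98204754344) 27440618486 51332298458
  52100264186 (-52819457002)"
| "gram_R17 E15 = case_ext3 12040994674 (-10732837902) (-10732837902) 110741291470 (-35583289004)
  (-21813823644) (-21813823644) 35040600592 11589614478 (-18948950982) (-19038634634) 120515171220
  (-30010030516) (-52729773350) (-52819457002) 71768407984"

primrec forms_R23 :: "ext3 \<Rightarrow> int list" where
  "forms_R23 E0 = [150, -150, 88, -7, 36, -23]"
| "forms_R23 E1 = [-83, -29, 76, 20, 29, -34]"
| "forms_R23 E2 = [-8, -90, -66, -14, -22, -34]"
| "forms_R23 E3 = [-20, 73, 33, -64, -11, -27]"
| "forms_R23 E4 = [15, -5, -36, 150, -13, -25]"
| "forms_R23 E5 = [68, -7, 1, -28, -82, 150]"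
| "forms_R23 E6 = [101, 32, -41, 45, -39, -31]"
| "forms_R23 E7 = [8, -7, -131, 20, 150, 96]"
| "forms_R23 E8 = [-139, -148, 8, -28, 0, -22]"
| "forms_R23 E9 = [-28, 119, 150, 12, 61, -27]"
| "forms_R23 E10 = [-87, 64, -106, -23, -67, -29]"
| "forms_R23 E11 = [111, 42, -31, -107, 68, -42]"
| "forms_R23 E12 = [46, 19, 42, 77, 11, -30]"
| "forms_R23 E13 = [24, 10, 83, 9, -43, 135]"
| "forms_R23 E14 = [83, 31, -79, 10, -13, -59]"
| "forms_R23 E15 = [-79, 23, -15, 25, 65, 78]"

primrec gram_R23 :: "ext3 \<Rightarrow> ext3 \<Rightarrow> int" where
  "gram_R23 E0 = case_ext3 28234370350 22914510660 7894428084 9488912086 2360862106 (-64459809652)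
  1991064470 (-28339100824) 13956667300 25477985478 (-9820334334) 22525887556 14558303932
  (-48591265534) 12776501646 (-24248901028)"
| "gram_R23 E1 = case_ext3 22914510660 28910262340 11558209304 12685108524 16830213240 (-92148392196)
  11389889324 (-46525226540) 13211996548 32038126212 70199460 21546671028 24025428376 (-71960174208)
  24944534656 (-35993987004)"
| "gram_R23 E2 = case_ext3 7894428084 11558209304 27290927464 13898735516 12169171708 (-75094880344)
  20347956852 (-56078129136) 16116637448 (-2877090316) 27229986580 22411559424 9833753784
  (-76814874052) 37424384444 (-48143850992)"
| "gram_R23 E3 = case_ext3 9488912086 12685108524 13898735516 24492728722 (-12810900942) (-58181875556)
  7284681710 (-55051806888) 11419251756 14869932646 16601908622 31730034312 2583188964 (-55714200294)
  22608403458 (-40244233048)"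
| "gram_R23 E4 = case_ext3 2360862106 16830213240 12169171708 (-12810900942) 65683270434 (-66844476624)
  31894749090 (-33660900764) (-1361758728) 6915079754 10101676838 (-23262192592) 37702143772
  (-52286903870) 30835351742 (-25033822200)"
| "gram_R23 E5 = case_ext3 (-64459809652) (-92148392196) (-75094880344) (-58181875556) (-66844476624)
  388775448488 (-66681172336) 188482985952 (-51721074392) (-83719407280) (-50263183796)
  (-113529225060) (-80729842636) 338754833264 (-139657878060) 168387968552"
| "gram_R23 E6 = case_ext3 1991064470 11389889324 20347956852 7284681710 31894749090 (-66681172336)
  28196896690 (-60862598932) 5536226216 1310915026 25398841066 2663007716 20548436024 (-63930977430)
  36360787146 (-44834828504)"
| "gram_R23 E7 = case_ext3 (-28339100824) (-46525226540) (-56078129136) (-55051806888) (-33660900764)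
  188482985952 (-60862598932) 244727520816 (-36269728208) (-29275997156) (-67280702896) (-30875325404)
  (-42572259252) 176573120964 (-87502031072) 157743569808"
| "gram_R23 E8 = case_ext3 13956667300 13211996548 16116637448 11419251756 (-1361758728) (-51721074392)
  5536226216 (-36269728208) 16808158628 5519138764 9227469680 19198766124 4692594096 (-48504296380)
  17716901584 (-29718691020)"
| "gram_R23 E9 = case_ext3 25477985478 32038126212 (-2877090316) 14869932646 6915079754 (-83719407280)
  1310915026 (-29275997156) 5519138764 51118304406 (-15735097450) 26151524308 24371009796
  (-55079983906) 12365219590 (-20911533748)"
| "gram_R23 E10 = case_ext3 (-9820334334) 70199460 27229986580 16601908622 10101676838 (-50263183796)
  25398841066 (-67280702896) 9227469680 (-15735097450) 43089134822 13123465840 2932661544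
  (-62400682582) 38466302426 (-50586415004)"
| "gram_R23 E11 = case_ext3 22525887556 21546671028 22411559424 31730034312 (-23262192592)
  (-113529225060) 2663007716 (-30875325404) 19198766124 26151524308 13123465840 74023190968 2515643512
  (-106250625864) 37745574292 (-43799576520)"
| "gram_R23 E12 = case_ext3 14558303932 24025428376 9833753784 2583188964 37702143772 (-80729842636)
  20548436024 (-42572259252) 4692594096 24371009796 2932661544 2515643512 31078261264 (-61807523264)
  27032923468 (-31446997752)"
| "gram_R23 E13 = case_ext3 (-48591265534) (-71960174208) (-76814874052) (-55714200294) (-52286903870)
  338754833264 (-63930977430) 176573120964 (-48504296380) (-55079983906) (-62400682582)
  (-106250625864) (-61807523264) 307761525782 (-132744578782) 159590348124"
| "gram_R23 E14 = case_ext3 12776501646 24944534656 37424384444 22608403458 30835351742 (-139657878060)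
  36360787146 (-87502031072) 17716901584 12365219590 38466302426 37745574292 27032923468
  (-132744578782) 63900184126 (-75685664388)"
| "gram_R23 E15 = case_ext3 (-24248901028) (-35993987004) (-48143850992) (-40244233048) (-25033822200)
  168387968552 (-44834828504) 157743569808 (-29718691020) (-20911533748) (-50586415004) (-43799576520)
  (-31446997752) 159590348124 (-75685664388) 115121918728"

primrec forms_R30 :: "ext3 \<Rightarrow> int list" where
  "forms_R30 E0 = [302, 161, 0, 177]"
| "forms_R30 E1 = [39, -345, 0, -13]"
| "forms_R30 E2 = [-45, -153, -500, 62]"
| "forms_R30 E3 = [-40, 500, 413, 61]"
| "forms_R30 E4 = [-45, -153, 500, 62]"
| "forms_R30 E5 = [-40, 500, -413, 61]"
| "forms_R30 E6 = [-500, 23, 0, 237]"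
| "forms_R30 E7 = [-350, 149, 0, -500]"
| "forms_R30 E8 = [-52, 238, 0, 123]"
| "forms_R30 E9 = [346, -245, 0, -65]"
| "forms_R30 E10 = [-87, -147, -293, -11]"
| "forms_R30 E11 = [232, 55, 344, -112]"
| "forms_R30 E12 = [-87, -147, 293, -11]"
| "forms_R30 E13 = [232, 55, -344, -112]"
| "forms_R30 E14 = [267, 147, 0, 171]"
| "forms_R30 E15 = [247, 250, 0, -267]"

primrec gram_R30 :: "ext3 \<Rightarrow> ext3 \<Rightarrow> int" where
  "gram_R30 E0 = case_ext3 7593248482 (-3697123566) 675155700 6801619534 675155700 6801619534
  8295304586 (-15722918956) 6450487162 (-4514151346) (-1768457874) (-3298998340) (-1768457874)
  (-3298998340) 7253751234 (-6761702230)"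
| "gram_R30 E1 = case_ext3 (-3697123566) 7007364180 2936833938 (-10261413606) 2936833938 (-10261413606)
  (-1064461722) (-1758421680) (-5120817114) 5118892878 2998652940 (-828583692) 2998652940 (-828583692)
  (-3399303060) (-4381007892)"
| "gram_R30 E2 = case_ext3 675155700 2936833938 18844635702 (-17569729236) (-14614364298) 10067404764
  2638725264 (-7324993512) (-659121012) 1414318860 10990328502 (-13347379308) (-8616645498) 9672412692
  729078138 (-5443463538)"
| "gram_R30 E3 = case_ext3 6801619534 (-10261413606) (-17569729236) 26782736284 10067404764 3954463600
  3472461014 (-1527481000) 8423689066 (-7947248110) (-12533488944) 9796050272 3661871580 (-9218297920)
  6320981802 4174194566"
| "gram_R30 E4 = case_ext3 675155700 2936833938 (-14614364298) 10067404764 18844635702 (-17569729236)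
  2638725264 (-7324993512) (-659121012) 1414318860 (-8616645498) 9672412692 10990328502 (-13347379308)
  729078138 (-5443463538)"
| "gram_R30 E5 = case_ext3 6801619534 (-10261413606) 10067404764 3954463600 (-17569729236) 26782736284
  3472461014 (-1527481000) 8423689066 (-7947248110) 3661871580 (-9218297920) (-12533488944) 9796050272
  6320981802 4174194566"
| "gram_R30 E6 = case_ext3 8295304586 (-1064461722) 2638725264 3472461014 2638725264 3472461014
  10939077322 (-22670128508) 5960953106 (-3342951770) (-693264390) (-5080316348) (-693264390)
  (-5080316348) 8005096230 (-11919977258)"
| "gram_R30 E7 = case_ext3 (-15722918956) (-1758421680) (-7324993512) (-1527481000) (-7324993512)
  (-1527481000) (-22670128508) 49651134796 (-9806465248) 4118805820 (-214116288) 11288703820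
  (-214116288) 11288703820 (-15262769712) 27971055100"
| "gram_R30 E8 = case_ext3 6450487162 (-5120817114) (-659121012) 8423689066 (-659121012) 8423689066
  5960953106 (-9806465248) 6244123990 (-4965816634) (-2310663414) (-1898343640) (-2310663414)
  (-1898343640) 6112956054 (-2864363470)"
| "gram_R30 E9 = case_ext3 (-4514151346) 5118892878 1414318860 (-7947248110) 1414318860 (-7947248110)
  (-3342951770) 4118805820 (-4965816634) 4358108482 2242465266 633872404 2242465266 633872404
  (-4240225506) (-216985466)"
| "gram_R30 E10 = case_ext3 (-1768457874) 2998652940 10990328502 (-12533488944) (-8616645498)
  3661871580 (-693264390) (-214116288) (-2310663414) 2242465266 7035962826 (-6984476820) (-4453723938)
  6505121292 (-1634494284) (-1590015804)"
| "gram_R30 E11 = case_ext3 (-3298998340) (-828583692) (-13347379308) 9796050272 9672412692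
  (-9218297920) (-5080316348) 11288703820 (-1898343640) 633872404 (-6984476820) 10531714084 6505121292
  (-5305902812) (-3215858556) 6597773416"
| "gram_R30 E12 = case_ext3 (-1768457874) 2998652940 (-8616645498) 3661871580 10990328502
  (-12533488944) (-693264390) (-214116288) (-2310663414) 2242465266 (-4453723938) 6505121292
  7035962826 (-6984476820) (-1634494284) (-1590015804)"
| "gram_R30 E13 = case_ext3 (-3298998340) (-828583692) 9672412692 (-9218297920) (-13347379308)
  9796050272 (-5080316348) 11288703820 (-1898343640) 633872404 6505121292 (-5305902812) (-6984476820)
  10531714084 (-3215858556) 6597773416"
| "gram_R30 E14 = case_ext3 7253751234 (-3399303060) 729078138 6320981802 729078138 6320981802
  8005096230 (-15262769712) 6112956054 (-4240225506) (-1634494284) (-3215858556) (-1634494284)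
  (-3215858556) 6932945124 (-6658864716)"
| "gram_R30 E15 = case_ext3 (-6761702230) (-4381007892) (-5443463538) 4174194566 (-5443463538)
  4174194566 (-11919977258) 27971055100 (-2864363470) (-216985466) (-1590015804) 6597773416
  (-1590015804) 6597773416 (-6658864716) 17454880096"

primrec forms_R33 :: "ext3 \<Rightarrow> int list" where
  "forms_R33 E0 = [-197, 58, 73, 249, 7]"
| "forms_R33 E1 = [-121, 30, -163, -6, -17]"
| "forms_R33 E2 = [280, -65, -30, -63, 75]"
| "forms_R33 E3 = [-153, 112, 0, 38, 199]"
| "forms_R33 E4 = [-300, -59, 220, -144, -6]"
| "forms_R33 E5 = [-147, -87, -17, 208, -245]"
| "forms_R33 E6 = [141, -37, 300, 125, 30]"
| "forms_R33 E7 = [-74, 47, -103, -240, -57]"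
| "forms_R33 E8 = [18, 65, 90, 300, 27]"
| "forms_R33 E9 = [52, 37, -85, -3, -39]"
| "forms_R33 E10 = [74, -300, -21, 90, 3]"
| "forms_R33 E11 = [188, 17, -151, 174, 275]"
| "forms_R33 E12 = [255, 43, 237, -205, -28]"
| "forms_R33 E13 = [253, 137, -18, 113, -300]"
| "forms_R33 E14 = [-76, 31, 184, -14, 79]"
| "forms_R33 E15 = [-41, -35, -186, -31, -20]"

primrec gram_R33 :: "ext3 \<Rightarrow> ext3 \<Rightarrow> int" where
  "gram_R33 E0 = case_ext3 38693051236 (-7582440788) (-9159684756) 11323995582 (-11693119248)
  21641535028 30074164898 (-38504161942) 46974573608 (-4436130614) 8210319358 24569048534
  (-19045620676) 9523272478 7904538816 (-12888531598)"
| "gram_R33 E1 = case_ext3 (-7582440788) 16267682508 (-1730714156) (-10691025562) (-19799891120)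
  14270524836 (-30119617758) 13865635314 (-10471166040) 10291658730 (-369528154) (-2156937634)
  (-19440245420) 19058646958 (-21237291280) 18234010578"
| "gram_R33 E2 = case_ext3 (-9159684756) (-1730714156) 22509550752 46867089448 440492536 (-67270736892)
  (-1447136080) (-4690330820) (-6214491880) (-8657551188) 1916424220 65089850364 (-4215125540)
  (-80366695352) 16669236896 (-306055896)"
| "gram_R33 E3 = case_ext3 11323995582 (-10691025562) 46867089448 135450499622 (-8289004520)
  (-160075734894) 21687070282 (-41848022572) 25772210540 (-25122763280) (-2910594948) 186520152768
  (-22053527042) (-193650683846) 52852372624 (-14711774770)"
| "gram_R33 E4 = case_ext3 (-11693119248) (-19799891120) 440492536 (-8289004520) 40086695688
  (-12875299768) 27104718608 7139566560 (-14304931528) (-10059096496) (-6410533512) (-38707978176)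
  46008102280 (-7155121744) 22189119048 (-19867077248)"
| "gram_R33 E5 = case_ext3 21641535028 14270524836 (-67270736892) (-160075734894) (-12875299768)
  226148111124 (-12224305202) 18782020414 10893728352 31665884422 13497602514 (-203291064718)
  (-4139852332) 255955717954 (-68470861464) 15148271790"
| "gram_R33 E6 = case_ext3 30074164898 (-30119617758) (-1447136080) 21687070282 27104718608
  (-12224305202) 63128579022 (-40415999516) 38551180324 (-18838284688) 5297289012 13931135560
  22923175474 (-26110289010) 37980650880 (-35575295798)"
| "gram_R33 E7 = case_ext3 (-38504161942) 13865635314 (-4690330820) (-41848022572) 7139566560
  18782020414 (-40415999516) 49589896094 (-50124866492) 13126418082 (-14310694670) (-66718333370)
  19416426626 44139342864 (-23577303536) 18512063944"
| "gram_R33 E8 = case_ext3 46974573608 (-10471166040) (-6214491880) 25772210540 (-14304931528)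
  10893728352 38551180324 (-50124866492) 58317483328 (-7866987004) 10388569620 46534676572
  (-24311838424) (-7121701988) 14557473488 (-16969919884)"
| "gram_R33 E9 = case_ext3 (-4436130614) 10291658730 (-8657551188) (-25122763280) (-10059096496)
  31665884422 (-18838284688) 13126418082 (-7866987004) 9457930382 (-1765518914) (-28628590894)
  (-7091947886) 40745860180 (-18898685712) 11355141588"
| "gram_R33 E10 = case_ext3 8210319358 (-369528154) 1916424220 (-2910594948) (-6410533512) 13497602514
  5297289012 (-14310694670) 10388569620 (-1765518914) 23030294918 12323457050 (-16012237074)
  (-5359599512) (-3999963640) 2569039312"
| "gram_R33 E11 = case_ext3 24569048534 (-2156937634) 65089850364 186520152768 (-38707978176)
  (-203291064718) 13931135560 (-66718333370) 46534676572 (-28628590894) 12323457050 282216721318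
  (-65719545842) (-261979442476) 55396713744 (-5567932652)"
| "gram_R33 E12 = case_ext3 (-19045620676) (-19440245420) (-4215125540) (-22053527042) 46008102280
  (-4139852332) 22923175474 19416426626 (-24311838424) (-7091947886) (-16012237074) (-65719545842)
  58536632036 13934737342 19198188912 (-19902946718)"
| "gram_R33 E13 = case_ext3 9523272478 19058646958 (-80366695352) (-193650683846) (-7155121744)
  255955717954 (-26110289010) 44139342864 (-7121701988) 40745860180 (-5359599512) (-261979442476)
  13934737342 311387802854 (-80977991936) 18952860354"
| "gram_R33 E14 = case_ext3 7904538816 (-21237291280) 16669236896 52852372624 22189119048
  (-68470861464) 37980650880 (-23577303536) 14557473488 (-18898685712) (-3999963640) 55396713744
  19198188912 (-80977991936) 40332761520 (-24652182256)"
| "gram_R33 E15 = case_ext3 (-12888531598) 18234010578 (-306055896) (-14711774770) (-19867077248)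
  15148271790 (-35575295798) 18512063944 (-16969919884) 11355141588 2569039312 (-5567932652)
  (-19902946718) 18952860354 (-24652182256) 21748344790"

text \<open>Roots 2 and 3 lie in one class of the extremal graph, whose further vertices have kinds
  \<open>E9\<close>, \<open>E14\<close> and \<open>E15\<close> in equal shares. Accordingly the rows
  of \<open>E9\<close> and \<open>E14\<close> are opposite and that of \<open>E15\<close> is
  zero.\<close>

primrec forms_R37 :: "ext3 \<Rightarrow> int list" where
  "forms_R37 E0 = [500, 242, 0, 51, 0, 0]"
| "forms_R37 E1 = [-266, -252, 0, 448, 0, 0]"
| "forms_R37 E2 = [46, -386, -180, -78, 32, 0]"
| "forms_R37 E3 = [-76, 500, 1, 49, 395, 0]"
| "forms_R37 E4 = [46, -386, 180, -78, -32, 0]"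
| "forms_R37 E5 = [-76, 500, -1, 49, -395, 0]"
| "forms_R37 E6 = [239, 179, 0, -465, 0, 0]"
| "forms_R37 E7 = [-110, -126, 0, 4, 0, 0]"
| "forms_R37 E8 = [-442, 350, 0, -116, 0, 0]"
| "forms_R37 E9 = [122, 35, 0, 500, 0, 0]"
| "forms_R37 E10 = [-34, -158, -500, -221, -9, 0]"
| "forms_R37 E11 = [61, 22, 2, 252, 500, 1]"
| "forms_R37 E12 = [-34, -158, 500, -221, 9, 0]"
| "forms_R37 E13 = [61, 13, -2, 248, -500, -1]"
| "forms_R37 E14 = [-122, -35, 0, -500, 0, 0]"
| "forms_R37 E15 = [0, 0, 0, 0, 0, 0]"

primrec gram_R37 :: "ext3 \<Rightarrow> ext3 \<Rightarrow> int" where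
  "gram_R37 E0 = case_ext3 4509342374 (-794739456) (-6641235932) 8203812578 (-6641235932) 8203812578
  (-500314306) (-2025872568) 4377689048 4361861960 (-4163302010) 2266833976 (-4163302010) 2095027984
  (-4361861960) 0"
| "gram_R37 E1 = case_ext3 (-794739456) 33614213248 1207180800 (-4971682688) 1207180800 (-4971682688)
  (-33521569536) 2368119040 (-13210346240) 32183246144 (-11890933376) 16148916672 (-11890933376)
  16034329472 (-32183246144) 0"
| "gram_R37 E2 = case_ext3 (-6641235932) 1207180800 16094179160 (-759743492) 5112307928 (-25523080292)
  821728660 3117512304 (-7504744880) (-6583873904) 18674534756 12226725680 (-5681461660)
  (-18810599584) 6583873904 0"
| "gram_R37 E3 = case_ext3 8203812578 (-4971682688) (-759743492) 169794748472 (-25523080292)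
  (-136493213132) 2473642058 (-4066452008) 10614060168 4716207544 (-10289230376) 196372323032
  (-3172071636) (-191656115488) (-4716207544) 0"
| "gram_R37 E4 = case_ext3 (-6641235932) 1207180800 5112307928 (-25523080292) 16094179160 (-759743492)
  821728660 3117512304 (-7504744880) (-6583873904) (-5681461660) (-19082676880) 18674534756
  12498802976 6583873904 0"
| "gram_R37 E5 = case_ext3 8203812578 (-4971682688) (-25523080292) (-136493213132) (-759743492)
  169794748472 2473642058 (-4066452008) 10614060168 4716207544 (-3172071636) (-191334160776)
  (-10289230376) 196050368320 (-4716207544) 0"
| "gram_R37 E6 = case_ext3 (-500314306) (-33521569536) 821728660 2473642058 821728660 2473642058
  33819431846 (-1774953912) 11848941656 (-33598448296) 13193834206 (-16882903784) 13193834206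
  (-16715544512) 33598448296 0"
| "gram_R37 E7 = case_ext3 (-2025872568) 2368119040 3117512304 (-4066452008) 3117512304 (-4066452008)
  (-1774953912) 1052050720 (-2881170848) (-11295040) 1172595016 (-41426400) 1172595016 30131360
  11295040 0"
| "gram_R37 E8 = case_ext3 4377689048 (-13210346240) (-7504744880) 10614060168 (-7504744880)
  10614060168 11848941656 (-2881170848) 10197148704 (-7761465152) 168638936 (-3812062880) 168638936
  (-3949402272) 7761465152 0"
| "gram_R37 E9 = case_ext3 4361861960 32183246144 (-6583873904) 4716207544 (-6583873904) 4716207544
  (-33598448296) (-11295040) (-7761465152) 36703906032 (-16545186744) 18508638976 (-16545186744)
  18195267056 (-36703906032) 0"
| "gram_R37 E10 = case_ext3 (-4163302010) (-11890933376) 18674534756 (-10289230376) (-5681461660)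
  (-3172071636) 13193834206 1172595016 168638936 (-16545186744) 43472197796 (-12939001344)
  (-25912810712) (-3606185400) 16545186744 0"
| "gram_R37 E11 = case_ext3 2266833976 16148916672 12226725680 196372323032 (-19082676880)
  (-191334160776) (-16882903784) (-41426400) (-3812062880) 18508638976 (-12939001344) 254727816608
  (-3828291344) (-236219177632) (-18508638976) 0"
| "gram_R37 E12 = case_ext3 (-4163302010) (-11890933376) (-5681461660) (-3172071636) 18674534756
  (-10289230376) 13193834206 1172595016 168638936 (-16545186744) (-25912810712) (-3828291344)
  43472197796 (-12716895400) 16545186744 0"
| "gram_R37 E13 = case_ext3 2095027984 16034329472 (-18810599584) (-191656115488) 12498802976
  196050368320 (-16715544512) 30131360 (-3949402272) 18195267056 (-3606185400) (-236219177632)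
  (-12716895400) 254414444688 (-18195267056) 0"
| "gram_R37 E14 = case_ext3 (-4361861960) (-32183246144) 6583873904 (-4716207544) 6583873904
  (-4716207544) 33598448296 11295040 7761465152 (-36703906032) 16545186744 (-18508638976) 16545186744
  (-18195267056) 36703906032 0"
| "gram_R37 E15 = case_ext3 0 0 0 0 0 0 0 0 0 0 0 0 0 0 0 0"

primrec forms_R41 :: "ext3 \<Rightarrow> int list" where
  "forms_R41 E0 = [387, -1000, 451, 1000, 158, -43]"
| "forms_R41 E1 = [358, -254, -33, -645, -361, -331]"
| "forms_R41 E2 = [-17, -8, 1000, -78, 291, -189]"
| "forms_R41 E3 = [-619, -350, -548, 342, 21, -151]"
| "forms_R41 E4 = [-17, -8, 1000, -78, 291, -189]"
| "forms_R41 E5 = [-619, -350, -548, 342, 21, -151]"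
| "forms_R41 E6 = [-79, -26, 604, 111, -746, 1000]"
| "forms_R41 E7 = [427, -389, -298, -533, 1000, 849]"
| "forms_R41 E8 = [1000, 892, -382, 770, 68, -156]"
| "forms_R41 E9 = [134, -174, -416, -545, -348, -329]"
| "forms_R41 E10 = [-489, 523, 241, 16, 350, -36]"
| "forms_R41 E11 = [-105, -64, -677, 20, 191, -281]"
| "forms_R41 E12 = [-489, 523, 241, 16, 350, -36]"
| "forms_R41 E13 = [-105, -64, -677, 20, 191, -281]"
| "forms_R41 E14 = [-651, 264, -251, 277, -16, 683]"
| "forms_R41 E15 = [326, 35, -807, 13, -93, 642]"

primrec gram_R41 :: "ext3 \<Rightarrow> ext3 \<Rightarrow> int" where
  "gram_R41 E0 = case_ext3 16914212968 (-7025485014) 4182378664 4827054136 4182378664 4827054136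
  (-7818398790) (-9467685304) 9346110376 (-6804341446) 1637049326 1605472336 1637049326 1605472336
  (-2868437088) (-7224499292)"
| "gram_R41 E1 = case_ext3 (-7025485014) 28744201118 8962700200 6050416312 8962700200 6050416312
  (-53485920006) (-55233950892) 1968193244 27662293824 (-1640795140) 14878124868 (-1640795140)
  14878124868 (-42993168392) (-37255306024)"
| "gram_R41 E2 = case_ext3 4182378664 8962700200 14329020474 1881785766 14329020474 1881785766
  (-36420121398) (-22321917832) 2876110952 6747495794 5230755618 7200177010 5230755618 7200177010
  (-25020696688) (-27063418114)"
| "gram_R41 E3 = case_ext3 4827054136 6050416312 1881785766 7673931090 1881785766 7673931090
  (-28883692986) (-23860226260) 8157983912 7636523918 326929146 9963282382 326929146 9963282382
  (-16530221248) (-15045221002)"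
| "gram_R41 E4 = case_ext3 4182378664 8962700200 14329020474 1881785766 14329020474 1881785766
  (-36420121398) (-22321917832) 2876110952 6747495794 5230755618 7200177010 5230755618 7200177010
  (-25020696688) (-27063418114)"
| "gram_R41 E5 = case_ext3 4827054136 6050416312 1881785766 7673931090 1881785766 7673931090
  (-28883692986) (-23860226260) 8157983912 7636523918 326929146 9963282382 326929146 9963282382
  (-16530221248) (-15045221002)"
| "gram_R41 E6 = case_ext3 (-7818398790) (-53485920006) (-36420121398) (-28883692986) (-36420121398)
  (-28883692986) 196640971048 131258353128 (-29621346932) (-54527520466) (-12505500226) (-56525165466)
  (-12505500226) (-56525165466) 122682076900 114534664346"
| "gram_R41 E7 = case_ext3 (-9467685304) (-55233950892) (-22321917832) (-23860226260) (-22321917832)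
  (-23860226260) 131258353128 160430709496 (-27164627236) (-54734410736) 2783777404 (-36861398932)
  2783777404 (-36861398932) 102048789126 96845770868"
| "gram_R41 E8 = case_ext3 9346110376 1968193244 2876110952 8157983912 2876110952 8157983912
  (-29621346932) (-27164627236) 14762271016 3792287140 1840100568 9740938864 1840100568 9740938864
  (-15726112708) (-16138822924)"
| "gram_R41 E9 = case_ext3 (-6804341446) 27662293824 6747495794 7636523918 6747495794 7636523918
  (-54527520466) (-54734410736) 3792287140 27568074188 (-1920108904) 16321577894 (-1920108904)
  16321577894 (-41760412900) (-35332295226)"
| "gram_R41 E10 = case_ext3 1637049326 (-1640795140) 5230755618 326929146 5230755618 326929146
  (-12505500226) 2783777404 1840100568 (-1920108904) 4314705988 2633151890 4314705988 2633151890
  (-4502892630) (-6130494778)"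
| "gram_R41 E11 = case_ext3 1605472336 14878124868 7200177010 9963282382 7200177010 9963282382
  (-56525165466) (-36861398932) 9740938864 16321577894 2633151890 17739200338 2633151890 17739200338
  (-33564670932) (-29857666694)"
| "gram_R41 E12 = case_ext3 1637049326 (-1640795140) 5230755618 326929146 5230755618 326929146
  (-12505500226) 2783777404 1840100568 (-1920108904) 4314705988 2633151890 4314705988 2633151890
  (-4502892630) (-6130494778)"
| "gram_R41 E13 = case_ext3 1605472336 14878124868 7200177010 9963282382 7200177010 9963282382
  (-56525165466) (-36861398932) 9740938864 16321577894 2633151890 17739200338 2633151890 17739200338
  (-33564670932) (-29857666694)"
| "gram_R41 E14 = case_ext3 (-2868437088) (-42993168392) (-25020696688) (-16530221248) (-25020696688)
  (-16530221248) 122682076900 102048789126 (-15726112708) (-41760412900) (-4502892630) (-33564670932)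
  (-4502892630) (-33564670932) 85519243122 79993422114"
| "gram_R41 E15 = case_ext3 (-7224499292) (-37255306024) (-27063418114) (-15045221002) (-27063418114)
  (-15045221002) 114534664346 96845770868 (-16138822924) (-35332295226) (-6130494778) (-29857666694)
  (-6130494778) (-29857666694) 79993422114 78027920746"

primrec forms_R51 :: "ext3 \<Rightarrow> int list" where
  "forms_R51 E0 = [-367, 992, 133, -730, 624, -139, 311]"
| "forms_R51 E1 = [-448, -185, 92, 723, 304, -44, 160]"
| "forms_R51 E2 = [127, 431, -209, 121, -531, -292, 20]"
| "forms_R51 E3 = [881, 270, -146, -636, 612, 506, 867]"
| "forms_R51 E4 = [218, -691, 9, -196, -916, -361, 87]"
| "forms_R51 E5 = [52, -1000, 78, -298, 289, -459, 195]"
| "forms_R51 E6 = [877, 110, 12, -626, 1000, -173, -983]"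
| "forms_R51 E7 = [282, 101, -452, 61, -529, 1000, -538]"
| "forms_R51 E8 = [-1000, -563, -282, -951, 513, -102, 306]"
| "forms_R51 E9 = [241, 18, -875, 1000, 961, -200, 28]"
| "forms_R51 E10 = [-562, 948, 82, -115, -298, -253, -164]"
| "forms_R51 E11 = [-109, 212, 115, 168, -239, 587, 1000]"
| "forms_R51 E12 = [762, 47, -81, -688, -918, -184, -38]"
| "forms_R51 E13 = [652, 295, 1000, 604, 274, -322, 194]"
| "forms_R51 E14 = [-712, 517, 42, -94, -134, 23, -656]"
| "forms_R51 E15 = [-318, -607, 684, -52, 434, 855, -486]"

primrec gram_R51 :: "ext3 \<Rightarrow> ext3 \<Rightarrow> int" where
  "gram_R51 E0 = case_ext3 44400447386 1846362088 (-6041123836) 55724211552 (-3264945396) 30448526106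
  (-12811286780) (-59683938592) 44538038544 5946138868 (-6458366084) 28899779344 (-4198207106)
  11894001356 (-33505693496) (-31363367124)"
| "gram_R51 E1 = case_ext3 1846362088 20464202494 (-788550506) 12927920556 (-7988820302) 5526445616
  (-25051778900) (-24679909030) (-3857258886) 28947278332 (-7420876248) 22052074624 (-21313345642)
  21338792382 (-19670603462) (-14061794078)"
| "gram_R51 E2 = case_ext3 (-6041123836) (-788550506) 22856285270 (-31829322666) 31388436276
  14792508240 (-14639184638) (-35745363742) (-5846544246) (-3229821140) 15360830992 (-18292581200)
  21925547788 10287071438 (-1097277026) (-48075032514)"
| "gram_R51 E3 = case_ext3 55724211552 12927920556 (-31829322666) 179622683460 (-30872239290)
  1902195690 (-117598976256) (-7982455764) 59555141976 (-7185784386) (-45949120716) 173912539938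
  (-26480616864) (-3356211216) (-89089742172) 7640478972"
| "gram_R51 E4 = case_ext3 (-3264945396) (-7988820302) 31388436276 (-30872239290) 49211675294
  20649483082 (-30775417046) (-46494043966) (-865325922) (-22302047702) 20914283048 (-12026713106)
  40246347396 9157558942 (-5844056114) (-65888723362)"
| "gram_R51 E5 = case_ext3 30448526106 5526445616 14792508240 1902195690 20649483082 42936008834
  (-4141192798) (-91607108072) 28267623672 15793532552 10492485964 (-13449423076) 8026764072
  26957032892 (-22350373660) (-69271395224)"
| "gram_R51 E6 = case_ext3 (-12811286780) (-25051778900) (-14639184638) (-117598976256) (-30775417046)
  (-4141192798) 199124632024 38979808292 (-13260469152) 16470123730 24099512400 (-180600403934)
  (-8389636804) (-22010039856) 98065078000 67882168456"
| "gram_R51 E7 = case_ext3 (-59683938592) (-24679909030) (-35745363742) (-7982455764) (-46494043966)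
  (-91607108072) 38979808292 207526920346 (-50650704918) (-44500402132) (-19667820024) 7911297344
  (-9527248070) (-72438367542) 61082748518 160399865438"
| "gram_R51 E8 = case_ext3 44538038544 (-3857258886) (-5846544246) 59555141976 (-865325922) 28267623672
  (-13260469152) (-50650704918) 48192281130 (-1338663180) (-6463007664) 30918328320 2137178430
  2269932666 (-32066504394) (-29581364610)"
| "gram_R51 E9 = case_ext3 5946138868 28947278332 (-3229821140) (-7185784386) (-22302047702)
  15793532552 16470123730 (-44500402132) (-1338663180) 67205803552 (-5837259624) (-17403198248)
  (-39916024834) 27359984148 (-10424565560) (-20425180928)"
| "gram_R51 E10 = case_ext3 (-6458366084) (-7420876248) 15360830992 (-45949120716) 20914283048
  10492485964 24099512400 (-19667820024) (-6463007664) (-5837259624) 17316677644 (-46339741212)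
  18818240588 3563974544 17753683692 (-23810972740)"
| "gram_R51 E11 = case_ext3 28899779344 22052074624 (-18292581200) 173912539938 (-12026713106)
  (-13449423076) (-180600403934) 7911297344 30918328320 (-17403198248) (-46339741212) 212281552324
  (-18131314642) 3308938608 (-100599828152) (-3709095872)"
| "gram_R51 E12 = case_ext3 (-4198207106) (-21313345642) 21925547788 (-26480616864) 40246347396
  8026764072 (-8389636804) (-9527248070) 2137178430 (-39916024834) 18818240588 (-18131314642)
  44670783032 (-11367687194) 8845101590 (-33390910230)"
| "gram_R51 E13 = case_ext3 11894001356 21338792382 10287071438 (-3356211216) 9157558942 26957032892
  (-22010039856) (-72438367542) 2269932666 27359984148 3563974544 3308938608 (-11367687194)
  41051213926 (-23460998622) (-48027378158)"
| "gram_R51 E14 = case_ext3 (-33505693496) (-19670603462) (-1097277026) (-89089742172) (-5844056114)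
  (-22350373660) 98065078000 61082748518 (-32066504394) (-10424565560) 17753683692 (-100599828152)
  8845101590 (-23460998622) 68760060274 51628316098"
| "gram_R51 E15 = case_ext3 (-31363367124) (-14061794078) (-48075032514) 7640478972 (-65888723362)
  (-69271395224) 67882168456 160399865438 (-29581364610) (-20425180928) (-23810972740) (-3709095872)
  (-33390910230) (-48027378158) 51628316098 157609269482"

primrec forms_R63 :: "ext3 \<Rightarrow> int list" where
  "forms_R63 E0 = [22, 829, 1000, -170, 0, 0]"
| "forms_R63 E1 = [2, -57, 145, 162, -539, 13]"
| "forms_R63 E2 = [2, -57, 145, 162, 539, -13]"
| "forms_R63 E3 = [-988, 240, -104, -322, 0, 0]"
| "forms_R63 E4 = [707, -967, 473, 1000, 0, 0]"
| "forms_R63 E5 = [648, -655, 317, -733, 118, 976]"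
| "forms_R63 E6 = [648, -655, 317, -733, -118, -976]"
| "forms_R63 E7 = [778, -55, -363, -399, 0, 0]"
| "forms_R63 E8 = [-1000, 425, 346, -374, 0, 0]"
| "forms_R63 E9 = [-381, -651, 251, 92, -1000, -230]"
| "forms_R63 E10 = [-381, -651, 251, 92, 1000, 230]"
| "forms_R63 E11 = [485, -57, -379, -232, 0, 0]"
| "forms_R63 E12 = [-288, -158, -307, 611, 0, 0]"
| "forms_R63 E13 = [813, 1000, 96, 313, -338, 1000]"
| "forms_R63 E14 = [813, 1000, 96, 313, 338, -1000]"
| "forms_R63 E15 = [723, 109, -154, -394, 0, 0]"

primrec gram_R63 :: "ext3 \<Rightarrow> ext3 \<Rightarrow> int" where
  "gram_R63 E0 = case_ext3 6090412758 538884642 538884642 (-8010536) 797420422 2751794466 2751794466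
  (-1412526934) 2641817710 1077051262 1077051262 (-1767255302) (-2727298984) 320475636 320475636
  (-206412490)"
| "gram_R63 E1 = case_ext3 538884642 8722876862 (-7997318786) (-574315704) 1908996810 (-1085234434)
  (-584654978) (-894401130) (-291322086) 15454696034 (-14745739166) (-655736442) 674755392 7374058076
  (-6312806180) (-720533742)"
| "gram_R63 E2 = case_ext3 538884642 (-7997318786) 8722876862 (-574315704) 1908996810 (-584654978)
  (-1085234434) (-894401130) (-291322086) (-14745739166) 15454696034 (-655736442) 674755392
  (-6312806180) 7374058076 (-720533742)"
| "gram_R63 E3 = case_ext3 (-8010536) (-574315704) (-574315704) 1137899864 (-3414897920) 1897190492
  1897190492 1328010996 1047914728 (-437583088) (-437583088) 864740480 (-1636901764) (-990293324)
  (-990293324) 1209849944"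
| "gram_R63 E4 = case_ext3 797420422 1908996810 1908996810 (-3414897920) 10913397798 (-5724364282)
  (-5724364282) (-4601070602) (-2768910114) 1704082462 1704082462 (-3109197398) 4902985476 2897649472
  2897649472 (-4058453610)"
| "gram_R63 E5 = case_ext3 2751794466 (-1085234434) (-584654978) 1897190492 (-5724364282) 124414912556
  (-112928108756) 2137481176 3008225378 (-31322141786) 31194875814 952662026 (-4693579718)
  117903161954 (-122167497374) 2434576402"
| "gram_R63 E6 = case_ext3 2751794466 (-584654978) (-1085234434) 1897190492 (-5724364282)
  (-112928108756) 124414912556 2137481176 3008225378 31194875814 (-31322141786) 952662026
  (-4693579718) (-122167497374) 117903161954 2434576402"
| "gram_R63 E7 = case_ext3 (-1412526934) (-894401130) (-894401130) 1328010996 (-4601070602) 2137481176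
  2137481176 2276857564 603260986 (-867458970) (-867458970) 1667668890 (-1663154890) (-1314217546)
  (-1314217546) 1826931290"
| "gram_R63 E8 = case_ext3 2641817710 (-291322086) (-291322086) 1047914728 (-2768910114) 3008225378
  3008225378 603260986 2126907174 109746166 109746166 19163458 (-2714410752) (-839264852) (-839264852)
  1018805934"
| "gram_R63 E9 = case_ext3 1077051262 15454696034 (-14745739166) (-437583088) 1704082462 (-31322141786)
  31194875814 (-867458970) 109746166 35858582710 (-34685545290) (-735848878) 136869740 (-18699413064)
  19010282936 (-603476818)"
| "gram_R63 E10 = case_ext3 1077051262 (-14745739166) 15454696034 (-437583088) 1704082462 31194875814
  (-31322141786) (-867458970) 109746166 (-34685545290) 35858582710 (-735848878) 136869740 19010282936
  (-18699413064) (-603476818)"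
| "gram_R63 E11 = case_ext3 (-1767255302) (-655736442) (-655736442) 864740480 (-3109197398) 952662026
  952662026 1667668890 19163458 (-735848878) (-735848878) 1327578086 (-678332404) (-860118080)
  (-860118080) 1208247626"
| "gram_R63 E12 = case_ext3 (-2727298984) 674755392 674755392 (-1636901764) 4902985476 (-4693579718)
  (-4693579718) (-1663154890) (-2714410752) 136869740 136869740 (-678332404) 4015972950 1538885138
  1538885138 (-2000670744)"
| "gram_R63 E13 = case_ext3 320475636 7374058076 (-6312806180) (-990293324) 2897649472 117903161954
  (-122167497374) (-1314217546) (-839264852) (-18699413064) 19010282936 (-860118080) 1538885138
  128799556310 (-126078963242) (-1136978668)"
| "gram_R63 E14 = case_ext3 320475636 (-6312806180) 7374058076 (-990293324) 2897649472 (-122167497374)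
  117903161954 (-1314217546) (-839264852) 19010282936 (-18699413064) (-860118080) 1538885138
  (-126078963242) 128799556310 (-1136978668)"
| "gram_R63 E15 = case_ext3 (-206412490) (-720533742) (-720533742) 1209849944 (-4058453610) 2434576402
  2434576402 1826931290 1018805934 (-603476818) (-603476818) 1208247626 (-2000670744) (-1136978668)
  (-1136978668) 1630775382"

text \<open>A vertex of kind \<open>E7\<close> or \<open>E15\<close> would complete the triangle of
  roots to a K4; these rows are padded with zeros, as they are for \<open>R77\<close>.\<close>

primrec forms_R73 :: "ext3 \<Rightarrow> int list" where
  "forms_R73 E0 = [27, 0, 0, -289, -70, 247, 0]"
| "forms_R73 E1 = [195, -91, -524, 291, 122, -215, -375]"
| "forms_R73 E2 = [195, 91, 524, 291, 122, -215, 375]"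
| "forms_R73 E3 = [-79, 0, 0, -142, -451, -12, 0]"
| "forms_R73 E4 = [-489, 0, 0, 1000, -120, 981, 0]"
| "forms_R73 E5 = [-289, 9, -729, -142, 117, 76, -1000]"
| "forms_R73 E6 = [-289, -9, 729, -142, 117, 76, 1000]"
| "forms_R73 E7 = [0, 0, 0, 0, 0, 0, 0]"
| "forms_R73 E8 = [-318, 0, 0, -365, -179, 199, 0]"
| "forms_R73 E9 = [566, -1000, 195, 505, -14, -274, -114]"
| "forms_R73 E10 = [566, 1000, -195, 505, -14, -274, 114]"
| "forms_R73 E11 = [161, 0, 0, 43, -1000, -175, 0]"
| "forms_R73 E12 = [1000, 0, 0, -405, 64, 1000, 0]"
| "forms_R73 E13 = [-21, 154, 1000, 21, 389, -61, -903]"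
| "forms_R73 E14 = [-21, -154, -1000, 21, 389, -61, 903]"
| "forms_R73 E15 = [0, 0, 0, 0, 0, 0, 0]"

primrec gram_R73 :: "ext3 \<Rightarrow> ext3 \<Rightarrow> int" where
  "gram_R73 E0 = case_ext3 6459416748 (-6012698808) (-6012698808) 2182865074 18458965908 1528494014
  1528494014 0 6147979306 (-7310495652) (-7310495652) 592402004 22296960100 (-3100320916)
  (-3100320916) 0"
| "gram_R73 E1 = case_ext3 (-6012698808) 27643229524 (-15968616316) (-3716394350) (-16144868040)
  56538036308 (-58432972312) 0 (-6213011114) 12840707976 246458496 (-4379750344) (-19279564556)
  54490725174 (-46052139782) 0"
| "gram_R73 E2 = case_ext3 (-6012698808) (-15968616316) 27643229524 (-3716394350) (-16144868040)
  (-58432972312) 56538036308 0 (-6213011114) 246458496 12840707976 (-4379750344) (-19279564556)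
  (-46052139782) 54490725174 0"
| "gram_R73 E3 = case_ext3 2182865074 (-3716394350) (-3716394350) 13178741390 953188194 (-3223827134)
  (-3223827134) 0 5482129220 (-72708084) (-72708084) 28838291222 (-2291501912) (-11140890470)
  (-11140890470) 0"
| "gram_R73 E4 = case_ext3 18458965908 (-16144868040) (-16144868040) 953188194 94616387544 4097245374
  4097245374 0 14462998218 (-17911215096) (-17911215096) (-6766155756) 79980620160 (-7924520724)
  (-7924520724) 0"
| "gram_R73 E5 = case_ext3 1528494014 56538036308 (-58432972312) (-3223827134) 4097245374 153977975854
  (-150778400146) 0 535046204 14298700790 (-19676847790) (-8675058118) 7586344264 137790611074
  (-132854649782) 0"
| "gram_R73 E6 = case_ext3 1528494014 (-58432972312) 56538036308 (-3223827134) 4097245374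
  (-150778400146) 153977975854 0 535046204 (-19676847790) 14298700790 (-8675058118) 7586344264
  (-132854649782) 137790611074 0"
| "gram_R73 E7 = case_ext3 0 0 0 0 0 0 0 0 0 0 0 0 0 0 0 0"
| "gram_R73 E8 = case_ext3 6147979306 (-6213011114) (-6213011114) 5482129220 14462998218 535046204
  535046204 0 6878241894 (-6519252904) (-6519252904) 8214530238 17950955172 (-5562761166)
  (-5562761166) 0"
| "gram_R73 E9 = case_ext3 (-7310495652) 12840707976 246458496 (-72708084) (-17911215096) 14298700790
  (-19676847790) 0 (-6519252904) 11473752070 7000008994 5283375644 (-25760935748) 17126032384
  (-14713271768) 0"
| "gram_R73 E10 = case_ext3 (-7310495652) 246458496 12840707976 (-72708084) (-17911215096)
  (-19676847790) 14298700790 0 (-6519252904) 7000008994 11473752070 5283375644 (-25760935748)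
  (-14713271768) 17126032384 0"
| "gram_R73 E11 = case_ext3 592402004 (-4379750344) (-4379750344) 28838291222 (-6766155756)
  (-8675058118) (-8675058118) 0 8214530238 5283375644 5283375644 66360404092 (-19352349580)
  (-23843063628) (-23843063628) 0"
| "gram_R73 E12 = case_ext3 22296960100 (-19279564556) (-19279564556) (-2291501912) 79980620160
  7586344264 7586344264 0 17950955172 (-25760935748) (-25760935748) (-19352349580) 88639255348
  (-3781261812) (-3781261812) 0"
| "gram_R73 E13 = case_ext3 (-3100320916) 54490725174 (-46052139782) (-11140890470) (-7924520724)
  137790611074 (-132854649782) 0 (-5562761166) 17126032384 (-14713271768) (-23843063628) (-3781261812)
  135285395374 (-115357963366) 0"
| "gram_R73 E14 = case_ext3 (-3100320916) (-46052139782) 54490725174 (-11140890470) (-7924520724)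
  (-132854649782) 137790611074 0 (-5562761166) (-14713271768) 17126032384 (-23843063628) (-3781261812)
  (-115357963366) 135285395374 0"
| "gram_R73 E15 = case_ext3 0 0 0 0 0 0 0 0 0 0 0 0 0 0 0 0"

text \<open>In the extremal graph a further vertex is adjacent to exactly two corners of the
  triangle, and the rows of \<open>E11\<close>, \<open>E13\<close>, \<open>E14\<close> add up to
  zero. The rows repeat from \<open>E8\<close> on: these forms ignore the colour of the further
  vertex.\<close>

primrec forms_R77 :: "ext3 \<Rightarrow> int list" where
  "forms_R77 E0 = [-1000, 0, 0, 0, 0, 0]"
| "forms_R77 E1 = [718, -334, -1000, 163, -488, 0]"
| "forms_R77 E2 = [718, -666, 801, 325, 390, 0]"
| "forms_R77 E3 = [0, 488, 97, 1000, -200, 1]"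
| "forms_R77 E4 = [718, 1000, 199, -488, 97, 0]"
| "forms_R77 E5 = [0, -325, 390, -666, -800, 0]"
| "forms_R77 E6 = [0, -163, -487, -334, 1000, -1]"
| "forms_R77 E7 = [0, 0, 0, 0, 0, 0]"
| "forms_R77 E8 = [-1000, 0, 0, 0, 0, 0]"
| "forms_R77 E9 = [718, -334, -1000, 163, -488, 0]"
| "forms_R77 E10 = [718, -666, 801, 325, 390, 0]"
| "forms_R77 E11 = [0, 488, 97, 1000, -200, 1]"
| "forms_R77 E12 = [718, 1000, 199, -488, 97, 0]"
| "forms_R77 E13 = [0, -325, 390, -666, -800, 0]"
| "forms_R77 E14 = [0, -163, -487, -334, 1000, -1]"
| "forms_R77 E15 = [0, 0, 0, 0, 0, 0]"

primrec gram_R77 :: "ext3 \<Rightarrow> ext3 \<Rightarrow> int" where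
  "gram_R77 E0 = case_ext3 7676000000 (-5511368000) (-5511368000) 0 (-5511368000) 0 0 0 7676000000
  (-5511368000) (-5511368000) 0 (-5511368000) 0 0 0"
| "gram_R77 E1 = case_ext3 (-5511368000) 40234759086 (-12021082910) 22852336112 (-16327627584)
  (-12766422776) (-10085913336) 0 (-5511368000) 40234759086 (-12021082910) 22852336112 (-16327627584)
  (-12766422776) (-10085913336) 0"
| "gram_R77 E2 = case_ext3 (-5511368000) (-12021082910) 42799937854 44070785600 (-18919005872)
  (-31291511160) (-12779274440) 0 (-5511368000) (-12021082910) 42799937854 44070785600 (-18919005872)
  (-31291511160) (-12779274440) 0"
| "gram_R77 E3 = case_ext3 0 22852336112 44070785600 147665663914 (-66917153712) (-91675688720)
  (-55989975194) 0 0 22852336112 44070785600 147665663914 (-66917153712) (-91675688720) (-55989975194)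
  0"
| "gram_R77 E4 = case_ext3 (-5511368000) (-16327627584) (-18919005872) (-66917153712) 47115225648
  44081805936 22835347776 0 (-5511368000) (-16327627584) (-18919005872) (-66917153712) 47115225648
  44081805936 22835347776 0"
| "gram_R77 E5 = case_ext3 0 (-12766422776) (-31291511160) (-91675688720) 44081805936 87676352482
  3999336238 0 0 (-12766422776) (-31291511160) (-91675688720) 44081805936 87676352482 3999336238 0"
| "gram_R77 E6 = case_ext3 0 (-10085913336) (-12779274440) (-55989975194) 22835347776 3999336238
  51990638956 0 0 (-10085913336) (-12779274440) (-55989975194) 22835347776 3999336238 51990638956 0"
| "gram_R77 E7 = case_ext3 0 0 0 0 0 0 0 0 0 0 0 0 0 0 0 0"
| "gram_R77 E8 = case_ext3 7676000000 (-5511368000) (-5511368000) 0 (-5511368000) 0 0 0 7676000000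
  (-5511368000) (-5511368000) 0 (-5511368000) 0 0 0"
| "gram_R77 E9 = case_ext3 (-5511368000) 40234759086 (-12021082910) 22852336112 (-16327627584)
  (-12766422776) (-10085913336) 0 (-5511368000) 40234759086 (-12021082910) 22852336112 (-16327627584)
  (-12766422776) (-10085913336) 0"
| "gram_R77 E10 = case_ext3 (-5511368000) (-12021082910) 42799937854 44070785600 (-18919005872)
  (-31291511160) (-12779274440) 0 (-5511368000) (-12021082910) 42799937854 44070785600 (-18919005872)
  (-31291511160) (-12779274440) 0"
| "gram_R77 E11 = case_ext3 0 22852336112 44070785600 147665663914 (-66917153712) (-91675688720)
  (-55989975194) 0 0 22852336112 44070785600 147665663914 (-66917153712) (-91675688720) (-55989975194)
  0"
| "gram_R77 E12 = case_ext3 (-5511368000) (-16327627584) (-18919005872) (-66917153712) 47115225648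
  44081805936 22835347776 0 (-5511368000) (-16327627584) (-18919005872) (-66917153712) 47115225648
  44081805936 22835347776 0"
| "gram_R77 E13 = case_ext3 0 (-12766422776) (-31291511160) (-91675688720) 44081805936 87676352482
  3999336238 0 0 (-12766422776) (-31291511160) (-91675688720) 44081805936 87676352482 3999336238 0"
| "gram_R77 E14 = case_ext3 0 (-10085913336) (-12779274440) (-55989975194) 22835347776 3999336238
  51990638956 0 0 (-10085913336) (-12779274440) (-55989975194) 22835347776 3999336238 51990638956 0"
| "gram_R77 E15 = case_ext3 0 0 0 0 0 0 0 0 0 0 0 0 0 0 0 0"

primrec forms3 :: "root3 \<Rightarrow> ext3 \<Rightarrow> int list" where
  "forms3 R = (\<lambda>_. [])"
| "forms3 R10 = forms_R10"
| "forms3 R11 = forms_R11"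
| "forms3 R13 = forms_R13"
| "forms3 R17 = forms_R17"
| "forms3 R23 = forms_R23"
| "forms3 R30 = forms_R30"
| "forms3 R33 = forms_R33"
| "forms3 R37 = forms_R37"
| "forms3 R41 = forms_R41"
| "forms3 R51 = forms_R51"
| "forms3 R63 = forms_R63"
| "forms3 R73 = forms_R73"
| "forms3 R77 = forms_R77"

primrec gram3 :: "root3 \<Rightarrow> ext3 \<Rightarrow> ext3 \<Rightarrow> int" where
  "gram3 R = (\<lambda>_ _. 0)"
| "gram3 R10 = gram_R10"
| "gram3 R11 = gram_R11"
| "gram3 R13 = gram_R13"
| "gram3 R17 = gram_R17"
| "gram3 R23 = gram_R23"
| "gram3 R30 = gram_R30"
| "gram3 R33 = gram_R33"
| "gram3 R37 = gram_R37"
| "gram3 R41 = gram_R41"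
| "gram3 R51 = gram_R51"
| "gram3 R63 = gram_R63"
| "gram3 R73 = gram_R73"
| "gram3 R77 = gram_R77"

section \<open>Positive semidefiniteness and the five-vertex integrands\<close>

definition high_weight :: int where "high_weight = 10000000000"

text \<open>The certificate can be rescaled as a whole, so only the size relative to
  \<open>high_weight\<close> and to the Gram tables matters; the power of ten there fixes the common
  scale.\<close>

definition low_weight :: int where "low_weight = 2300042189"

text \<open>A diagonal form in the values of the linear forms. With nonnegative weights the Gram
  matrix is positive semidefinite by construction, with no need to examine minors or
  eigenvalues.\<close>

fun wdot :: "int list \<Rightarrow> int list \<Rightarrow> int list \<Rightarrow> int" where
  "wdot [] xs ys = 0"
| "wdot (w # ws) xs ys = w * (hd xs * hd ys) + wdot ws (tl xs) (tl ys)"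

lemma wdot_commute: "wdot ws xs ys = wdot ws ys xs"
  by (induction ws arbitrary: xs ys) (simp_all add: mult.commute)

text \<open>Each coordinate contributes its weight times the square of a sum over \<open>U\<close>.
  The index set is general because it is the vertex set when a flag has one free vertex, but the set
  of ordered pairs for the flags over a single root.\<close>

lemma sum_wdot_nonneg:
  assumes "\<forall>w\<in>set ws. 0 \<le> w"
  shows "0 \<le> (\<Sum>u\<in>U. \<Sum>v\<in>U. wdot ws (L u) (L v))"
  using assms
proof (induction ws arbitrary: L)
  case (Cons w ws)
  have "(\<Sum>u\<in>U. \<Sum>v\<in>U. w * (hd (L u) * hd (L v))) = w * (\<Sum>u\<in>U. hd (L u))\<^sup>2"
    unfolding power2_eq_square sum_product by (simp only: sum_distrib_left)
  moreover have "0 \<le> (\<Sum>u\<in>U. \<Sum>v\<in>U. wdot ws (tl (L u)) (tl (L v)))"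
    using Cons.prems by (intro Cons.IH[of "\<lambda>u. tl (L u)"]) simp
  ultimately show ?case
    using Cons.prems by (simp add: sum.distrib)
qed simp

definition "all_ext3 = [E0,E1,E2,E3,E4,E5,E6,E7,E8,E9,E10,E11,E12,E13,E14,E15]"
definition "all_ext2 = [D0,D1,D2,D3,D4,D5,D6,D7]"
definition "all_ext1 = [P0,P1,P2,P3,P4,P5,P6,P7,P8,P9,P10,P11,P12,P13,P14,P15,P16,P17,P18,P19]"
definition "all_root3 = [R,R10,R11,R13,R17,R23,R30,R33,R37,R41,R51,R63,R73,R77]"

lemma all_ext [simp]: "f \<in> set all_ext3" "g \<in> set all_ext2" "k \<in> set all_ext1" "r \<in> set all_root3"
     apply (cases f; simp add: all_ext3_def)
    apply (cases g; simp add: all_ext2_def)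
   apply (cases k; simp add: all_ext1_def)
  apply (cases r; simp add: all_root3_def)
  done

text \<open>The enumeration of patterns looks up the left sides; the nonnegativity proofs use the
  right sides, where the squares are visible.\<close>

lemma gram3_table: "list_all (\<lambda>r. list_all (\<lambda>f. list_all (\<lambda>g.
    gram3 r f g = wdot (weights3 r) (forms3 r f) (forms3 r g)) all_ext3) all_ext3) all_root3"
  by code_simp

lemma gram_HH_table: "list_all (\<lambda>f. list_all (\<lambda>g.
    gram_HH f g = wdot weights_HH (forms_HH f) (forms_HH g)) all_ext2) all_ext2"
  by code_simp

lemma gram_HL_table: "list_all (\<lambda>f. list_all (\<lambda>g.
    gram_HL f g = wdot weights_HL (forms_HL f) (forms_HL g)) all_ext2) all_ext2"
  by code_simp

lemma gram_L_table: "list_all (\<lambda>f. list_all (\<lambda>g.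
    gram_L f g = wdot weights_L (forms_L f) (forms_L g)) all_ext1) all_ext1"
  by code_simp

lemma gram_eq:
  "gram3 r f g = wdot (weights3 r) (forms3 r f) (forms3 r g)"
  "gram_HH f' g' = wdot weights_HH (forms_HH f') (forms_HH g')"
  "gram_HL f' g' = wdot weights_HL (forms_HL f') (forms_HL g')"
  "gram_L f'' g'' = wdot weights_L (forms_L f'') (forms_L g'')"
  using gram3_table gram_HH_table gram_HL_table gram_L_table by (simp_all add: list_all_iff)

lemma weights_nonneg:
  "\<forall>w\<in>set (weights3 r). 0 \<le> w" "\<forall>w\<in>set weights_HH. 0 \<le> w"
  "\<forall>w\<in>set weights_HL. 0 \<le> w" "\<forall>w\<in>set weights_L. 0 \<le> w"
  by (cases r) (simp_all add: weights_HH_def weights_HL_def weights_L_def)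

type_synonym 'v form5 = "('v \<Rightarrow> 'v \<Rightarrow> bool) \<Rightarrow> ('v \<Rightarrow> bool) \<Rightarrow> 'v \<Rightarrow> 'v \<Rightarrow> 'v \<Rightarrow> 'v \<Rightarrow> 'v \<Rightarrow> int"

definition sq3_at :: "root3 \<Rightarrow> 'v form5" where
  "sq3_at r A h x y z u v = ite (r = R) 0
     (gram3 r (ext3 (A x u) (A y u) (A z u) (h u)) (ext3 (A x v) (A y v) (A z v) (h v)))"

definition sq3 :: "'v form5" where
  "sq3 A h x y z u v = sq3_at (root3 (h x) (h y) (h z) (A x y) (A x z) (A y z)) A h x y z u v"

text \<open>The factor 1 or -1 sums over \<open>z\<close> to deg x - (n - deg x), which is positive
  for high \<open>x\<close>. The square in \<open>u\<close>, \<open>v\<close> is thus multiplied by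
  a nonnegative quantity; this is how high degree enters apart from the test on edges.\<close>

definition sq2 :: "'v form5" where
  "sq2 A h x y z u v = ite (h x) (ite (A x y) (ite (A x z) 1 (-1) *
     ite (h y) (gram_HH (ext2 (A x u) (A y u) (h u)) (ext2 (A x v) (A y v) (h v)))
       (gram_HL (ext2 (A x u) (A y u) (h u)) (ext2 (A x v) (A y v) (h v)))) 0) 0"

definition sq1 :: "'v form5" where
  "sq1 A h x u v w z = ite (h x) 0
     (gram_L (ext1 (A x u) (A x v) (A u v) (h u) (h v)) (ext1 (A x w) (A x z) (A w z) (h w) (h z)))"

definition ind :: "bool \<Rightarrow> int" where
  "ind b = ite b 1 0"

text \<open>Integrand of the expression in \<open>high_pos\<close>: \<open>u\<close> is the common
  neighbour, and \<open>v\<close>, \<open>z\<close> produce n^2, \<open>m\<close>,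
  \<open>D x\<close> and \<open>T x\<close>. In the last summand \<open>z\<close> only produces the
  factor 2 deg x - n.\<close>

definition high_term :: "'v form5" where
  "high_term A h x y u v z = ite (h x) (ite (h y) (ite (A x y) (ite (A x u) (ite (A y u)
     (18 * ind (A v z) - 4 - 36 * (ind (A x v) * ind (A v z)) + 36 * (ind (A x v) * ind (A x z) * ind (A v z))
       + 18 * (ind (A u v) * (1 - 2 * ind (A x v)) * (2 * ind (A x z) - 1))) 0) 0) 0) 0) 0"

text \<open>Integrand of the expression in \<open>low_pos\<close>: the pair \<open>u\<close>,
  \<open>v\<close> produces n^2, \<open>m\<close>, \<open>D x\<close> and \<open>T x\<close>, while
  \<open>w\<close> and \<open>z\<close> produce the factors deg x and n - deg x, or n where they do
  not occur.\<close>

definition low_term :: "'v form5" where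
  "low_term A h x u v w z = ite (h x) 0
     ((9 * ind (A u v) - 4) * ((1 - ind (A x w)) * (1 - ind (A x z)))
       + 9 * (ind (A x u) * ind (A x v) * ind (A u v))
       - 18 * (ind (A x w) * ind (A x u) * ind (A u v)) + 9 * (ind (A x w) * ind (A x z) * ind (A u v)))"

section \<open>Symmetrisation over the orderings of five vertices\<close>

fun inserts :: "'v \<Rightarrow> 'v list \<Rightarrow> 'v list list" where
  "inserts x [] = [[x]]"
| "inserts x (y # ys) = (x # y # ys) # map ((#) y) (inserts x ys)"

text \<open>Positions are permuted, not values: five entries have 120 orderings even if some
  coincide, as tuples with repetitions require.\<close>

fun perms :: "'v list \<Rightarrow> 'v list list" where
  "perms [] = [[]]"
| "perms (x # xs) = concat (map (inserts x) (perms xs))"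

fun picks :: "'v list \<Rightarrow> ('v \<times> 'v list) list" where
  "picks [] = []"
| "picks (x # xs) = (x, xs) # map (\<lambda>(y, ys). (y, x # ys)) (picks xs)"

fun on5 :: "('v \<Rightarrow> 'v \<Rightarrow> 'v \<Rightarrow> 'v \<Rightarrow> 'v \<Rightarrow> int) \<Rightarrow> 'v list \<Rightarrow> int" where
  "on5 F [a, b, c, d, e] = F a b c d e"
| "on5 F _ = 0"

definition sum120 :: "('v \<Rightarrow> 'v \<Rightarrow> 'v \<Rightarrow> 'v \<Rightarrow> 'v \<Rightarrow> int) \<Rightarrow> 'v list \<Rightarrow> int" where
  "sum120 F xs = sum_list (map (on5 F) (perms xs))"

fun last_two :: "('v \<Rightarrow> 'v \<Rightarrow> int) \<Rightarrow> 'v list \<Rightarrow> int" where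
  "last_two F [d, e] = F d e"
| "last_two F _ = 0"

definition sum60 :: "('v \<Rightarrow> 'v \<Rightarrow> 'v \<Rightarrow> 'v \<Rightarrow> 'v \<Rightarrow> int) \<Rightarrow> 'v list \<Rightarrow> int" where
  "sum60 F xs = (\<Sum>(a, as) \<leftarrow> picks xs. \<Sum>(b, bs) \<leftarrow> picks as. \<Sum>(c, cs) \<leftarrow> picks bs. last_two (F a b c) cs)"

fun splits4 :: "('v \<Rightarrow> 'v \<Rightarrow> 'v \<Rightarrow> 'v \<Rightarrow> int) \<Rightarrow> 'v list \<Rightarrow> int" where
  "splits4 F [b, c, d, e] = F b c d e + F b d c e + F b e c d"
| "splits4 F _ = 0"

text \<open>Five choices of the root times three splittings of the rest into two pairs. The
  remaining factor 8 comes from swapping inside either pair and exchanging the pairs.\<close>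

definition sum15 :: "('v \<Rightarrow> 'v \<Rightarrow> 'v \<Rightarrow> 'v \<Rightarrow> 'v \<Rightarrow> int) \<Rightarrow> 'v list \<Rightarrow> int" where
  "sum15 F xs = (\<Sum>(a, as) \<leftarrow> picks xs. splits4 (F a) as)"

lemma sum120_eq_sum60:
  assumes s: "\<And>x y z u v. F x y z u v = F x y z v u"
  shows "sum120 F [a, b, c, d, e] = 2 * sum60 F [a, b, c, d, e]"
  unfolding sum120_def sum60_def
  \<comment> \<open>One instance per unordered pair, oriented so that every term is brought to the
    form with its last two arguments in alphabetical order.\<close>
  by (simp add: s[of _ _ _ d c] s[of _ _ _ b a] s[of _ _ _ c a] s[of _ _ _ d a] s[of _ _ _ e a]
      s[of _ _ _ c b] s[of _ _ _ d b] s[of _ _ _ e b] s[of _ _ _ e c] s[of _ _ _ e d])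

lemma sum120_eq_sum15:
  assumes s: "\<And>x u v w z. F x u v w z = F x v u w z" "\<And>x u v w z. F x u v w z = F x u v z w"
    "\<And>x u v w z. F x u v w z = F x w z u v"
  shows "sum120 F [a, b, c, d, e] = 8 * sum15 F [a, b, c, d, e]"
  unfolding sum120_def sum15_def by (simp add: s)

definition cert :: "('v \<Rightarrow> 'v \<Rightarrow> bool) \<Rightarrow> ('v \<Rightarrow> bool) \<Rightarrow> 'v list \<Rightarrow> int" where
  "cert A h xs = high_weight * sum120 (high_term A h) xs + low_weight * sum120 (low_term A h) xs
     + sum120 (sq3 A h) xs + sum120 (sq2 A h) xs + sum120 (sq1 A h) xs"

text \<open>\<open>cert\<close> treats all terms alike and sums well over tuples; this shorter
  version is the one that is evaluated on patterns.\<close>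

definition fast_cert :: "('v \<Rightarrow> 'v \<Rightarrow> bool) \<Rightarrow> ('v \<Rightarrow> bool) \<Rightarrow> 'v list \<Rightarrow> int" where
  "fast_cert A h xs = high_weight * sum120 (high_term A h) xs + low_weight * sum120 (low_term A h) xs
     + 2 * sum60 (sq3 A h) xs + 2 * sum60 (sq2 A h) xs + 8 * sum15 (sq1 A h) xs"

lemma ext1_swap: "ext1 a b c d e = ext1 b a c e d"
  by (simp add: ext1_def)

lemma cert_eq_fast_cert:
  assumes A: "\<And>u v. A u v = A v u"
  shows "cert A h [a, b, c, d, e] = fast_cert A h [a, b, c, d, e]"
proof -
  have 3: "sq3 A h x y z u v = sq3 A h x y z v u" for x y z u v
    by (simp add: sq3_def sq3_at_def gram_eq wdot_commute)
  have 2: "sq2 A h x y z u v = sq2 A h x y z v u" for x y z u v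
    by (simp add: sq2_def gram_eq wdot_commute)
  have 1: "sq1 A h x u v w z = sq1 A h x w z u v" for x u v w z
    by (simp add: sq1_def gram_eq wdot_commute)
  have s1': "sq1 A h x u v w z = sq1 A h x v u w z" for x u v w z
    by (simp add: sq1_def ext1_swap[of "A x u"] A[of u v])
  have s1'': "sq1 A h x u v w z = sq1 A h x u v z w" for x u v w z
    using 1 s1' by metis
  show ?thesis
    unfolding cert_def fast_cert_def
    by (simp only: sum120_eq_sum60[of "sq3 A h", OF 3] sum120_eq_sum60[of "sq2 A h", OF 2]
        sum120_eq_sum15[of "sq1 A h", OF s1' s1'' 1])
qed

section \<open>Enumeration of coloured five-vertex patterns\<close>

datatype vtx = V0 | V1 | V2 | V3 | V4

text \<open>The bits are the possible edges 01, 02, 12, 03, 13, 23, 04, 14, 24, 34, ordered by their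
  larger end.\<close>

datatype pat = Pat bool bool bool bool bool bool bool bool bool bool

fun adj :: "pat \<Rightarrow> vtx \<Rightarrow> vtx \<Rightarrow> bool" where
  "adj (Pat a b c d e f g h i j) V0 V0 = False"
| "adj (Pat a b c d e f g h i j) V0 V1 = a"
| "adj (Pat a b c d e f g h i j) V0 V2 = b"
| "adj (Pat a b c d e f g h i j) V0 V3 = d"
| "adj (Pat a b c d e f g h i j) V0 V4 = g"
| "adj (Pat a b c d e f g h i j) V1 V0 = a"
| "adj (Pat a b c d e f g h i j) V1 V1 = False"
| "adj (Pat a b c d e f g h i j) V1 V2 = c"
| "adj (Pat a b c d e f g h i j) V1 V3 = e"
| "adj (Pat a b c d e f g h i j) V1 V4 = h"
| "adj (Pat a b c d e f g h i j) V2 V0 = b"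
| "adj (Pat a b c d e f g h i j) V2 V1 = c"
| "adj (Pat a b c d e f g h i j) V2 V2 = False"
| "adj (Pat a b c d e f g h i j) V2 V3 = f"
| "adj (Pat a b c d e f g h i j) V2 V4 = i"
| "adj (Pat a b c d e f g h i j) V3 V0 = d"
| "adj (Pat a b c d e f g h i j) V3 V1 = e"
| "adj (Pat a b c d e f g h i j) V3 V2 = f"
| "adj (Pat a b c d e f g h i j) V3 V3 = False"
| "adj (Pat a b c d e f g h i j) V3 V4 = j"
| "adj (Pat a b c d e f g h i j) V4 V0 = g"
| "adj (Pat a b c d e f g h i j) V4 V1 = h"
| "adj (Pat a b c d e f g h i j) V4 V2 = i"
| "adj (Pat a b c d e f g h i j) V4 V3 = j"
| "adj (Pat a b c d e f g h i j) V4 V4 = False"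

text \<open>Once low vertices come first, a colouring is determined by the number of high vertices,
  so 6 colourings replace 32.\<close>

primrec last_high :: "nat \<Rightarrow> vtx \<Rightarrow> bool" where
  "last_high k V0 = (5 \<le> k)"
| "last_high k V1 = (4 \<le> k)"
| "last_high k V2 = (3 \<le> k)"
| "last_high k V3 = (2 \<le> k)"
| "last_high k V4 = (1 \<le> k)"

definition deg_in :: "('v \<Rightarrow> 'v \<Rightarrow> bool) \<Rightarrow> 'v list \<Rightarrow> 'v \<Rightarrow> int" where
  "deg_in A xs v = sum_list (map (\<lambda>u. ind (A v u)) xs)"

text \<open>Since \<open>1000 > 5 * (20 + 5)\<close>, sorting by this key puts the low vertices first.\<close>

definition key :: "('v \<Rightarrow> 'v \<Rightarrow> bool) \<Rightarrow> ('v \<Rightarrow> bool) \<Rightarrow> 'v list \<Rightarrow> 'v \<Rightarrow> int" where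
  "key A h xs v = ite (h v) 1000 0 + sum_list (map (\<lambda>u. ite (A v u) (20 + deg_in A xs u) 0) xs)"

fun ascending :: "int list \<Rightarrow> bool" where
  "ascending (x # y # zs) = ite (x \<le> y) (ascending (y # zs)) False"
| "ascending _ = True"

definition K4 :: "('v \<Rightarrow> 'v \<Rightarrow> bool) \<Rightarrow> 'v \<Rightarrow> 'v \<Rightarrow> 'v \<Rightarrow> 'v \<Rightarrow> bool" where
  "K4 A w x y z = ite (A w x) (ite (A w y) (ite (A x y) (ite (A w z) (ite (A x z) (A y z) False) False) False) False) False"

definition vs :: "vtx list" where
  "vs = [V0, V1, V2, V3, V4]"

text \<open>Demanding ascending keys breaks symmetry: every tuple can be sorted, so each coloured
  graph keeps at least one labelling while most labellings are skipped. Within a colour the key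
  compares degrees and then degree sums over neighbours, since in a five-vertex graph the latter are
  at most 16, below 20.\<close>

definition admissible :: "(vtx \<Rightarrow> bool) \<Rightarrow> (vtx \<Rightarrow> vtx \<Rightarrow> bool) \<Rightarrow> bool" where
  "admissible h A = ite (K4 A V0 V1 V2 V3) False (ite (K4 A V0 V1 V2 V4) False (ite (K4 A V0 V1 V3 V4) False
     (ite (K4 A V0 V2 V3 V4) False (ite (K4 A V1 V2 V3 V4) False (ascending (map (key A h vs) vs))))))"

definition pattern_ok :: "(vtx \<Rightarrow> bool) \<Rightarrow> pat \<Rightarrow> bool" where
  "pattern_ok h p = ite (admissible h (adj p)) (fast_cert (adj p) h vs \<le> 0) True"

definition both :: "(bool \<Rightarrow> 'a) list \<Rightarrow> 'a list" where
  "both fs = concat (map (\<lambda>f. [f False, f True]) fs)"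

definition pats :: "bool \<Rightarrow> pat list" where
  "pats a = both (both (both (both (both (both (both (both (both [Pat a]))))))))"

text \<open>The numerical core consists of twelve checks of 512 patterns each: six colourings times
  the two values of the first edge bit. Patterns that are not admissible pass without evaluating the
  certificate.\<close>

lemma pattern_ok_0_False: "list_all (pattern_ok (last_high 0)) (pats False)"
  by code_simp

lemma pattern_ok_0_True: "list_all (pattern_ok (last_high 0)) (pats True)"
  by code_simp

lemma pattern_ok_1_False: "list_all (pattern_ok (last_high 1)) (pats False)"
  by code_simp

lemma pattern_ok_1_True: "list_all (pattern_ok (last_high 1)) (pats True)"
  by code_simp

lemma pattern_ok_2_False: "list_all (pattern_ok (last_high 2)) (pats False)"
  by code_simp

lemma pattern_ok_2_True: "list_all (pattern_ok (last_high 2)) (pats True)"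
  by code_simp

lemma pattern_ok_3_False: "list_all (pattern_ok (last_high 3)) (pats False)"
  by code_simp

lemma pattern_ok_3_True: "list_all (pattern_ok (last_high 3)) (pats True)"
  by code_simp

lemma pattern_ok_4_False: "list_all (pattern_ok (last_high 4)) (pats False)"
  by code_simp

lemma pattern_ok_4_True: "list_all (pattern_ok (last_high 4)) (pats True)"
  by code_simp

lemma pattern_ok_5_False: "list_all (pattern_ok (last_high 5)) (pats False)"
  by code_simp

lemma pattern_ok_5_True: "list_all (pattern_ok (last_high 5)) (pats True)"
  by code_simp

section \<open>Summation over tuples\<close>

text \<open>Both sides list every placement of \<open>x\<close> and \<open>y\<close> around
  \<open>l\<close>, in both relative orders; only the order of listing differs.\<close>

lemma mset_inserts_inserts:
  "mset (concat (map (inserts x) (inserts y l))) = mset (concat (map (inserts y) (inserts x l)))"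
proof (induction l)
  case (Cons z l)
  have *: "mset (concat (map (\<lambda>w. (x # z # w) # map ((#) z) (inserts x w)) L)) =
      image_mset (\<lambda>w. x # z # w) (mset L) + image_mset ((#) z) (mset (concat (map (inserts x) L)))"
    for x :: 'a and L by (induction L) simp_all
  show ?case
    by (simp add: * Cons.IH image_mset.compositionality comp_def add.left_commute del: mset_concat)
qed simp

lemma mset_concat_map_cong:
  "mset xs = mset ys \<Longrightarrow> mset (concat (map f xs)) = mset (concat (map f ys))"
  by (simp add: mset_concat flip: sum_mset_sum_list)

lemma mset_perms_swap: "mset (perms (x # y # l)) = mset (perms (y # x # l))"
proof -
  have *: "mset (concat (map (inserts x) (concat (map (inserts y) L)))) =
      mset (concat (map (inserts y) (concat (map (inserts x) L))))" for L
    by (induction L) (simp_all add: mset_inserts_inserts[of x y])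
  show ?thesis by (simp add: *)
qed

lemma mset_perms_insort: "mset (perms (insort_key f x xs)) = mset (perms (x # xs))"
proof (induction xs)
  case (Cons y ys)
  have "mset (perms (y # insort_key f x ys)) = mset (perms (y # x # ys))"
    using mset_concat_map_cong[OF Cons.IH, of "inserts y"] by simp
  then show ?case
    using mset_perms_swap[of x y ys] by simp
qed simp

text \<open>Insertion sort moves an element only past its neighbours, so invariance under swaps at
  the head, propagated through the recursion of \<open>perms\<close>, is enough.\<close>

lemma mset_perms_sort: "mset (perms (sort_key f xs)) = mset (perms xs)"
proof (induction xs)
  case (Cons x xs)
  have "mset (perms (sort_key f (x # xs))) = mset (perms (x # sort_key f xs))"
    using mset_perms_insort by simp
  also have "\<dots> = mset (perms (x # xs))"
    using mset_concat_map_cong[OF Cons.IH, of "inserts x"] by simp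
  finally show ?case .
qed simp

lemma sum120_sort: "sum120 F (sort_key f xs) = sum120 F xs"
  unfolding sum120_def by (simp add: mset_perms_sort flip: sum_mset_sum_list)

lemma cert_sort: "cert A h (sort_key f xs) = cert A h xs"
  by (simp add: cert_def sum120_sort)

definition tuples :: "'v set \<Rightarrow> nat \<Rightarrow> 'v list set" where
  "tuples V n = {xs. set xs \<subseteq> V \<and> length xs = n}"

lemma sum_tuples_0 [simp]: "sum G (tuples V 0) = G []"
proof -
  have "tuples V 0 = {[]}" by (auto simp: tuples_def)
  then show ?thesis by simp
qed

lemma sum_tuples_Suc: "sum G (tuples V (Suc n)) = (\<Sum>x\<in>V. \<Sum>xs\<in>tuples V n. G (x # xs))"
proof -
  have "tuples V (Suc n) = (\<lambda>(x, xs). x # xs) ` (V \<times> tuples V n)"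
    by (auto simp: tuples_def length_Suc_conv image_iff)
  moreover have "inj_on (\<lambda>(x, xs). x # xs) (V \<times> tuples V n)"
    by (auto simp: inj_on_def)
  ultimately show ?thesis
    by (simp add: sum.reindex sum.cartesian_product case_prod_unfold)
qed

text \<open>Each tuple of length n + 1 arises n + 1 times, once for each position whose entry is
  taken as the inserted one.\<close>

lemma sum_inserts:
  fixes G :: "'v list \<Rightarrow> int"
  shows "(\<Sum>x\<in>V. \<Sum>ys\<in>tuples V n. sum_list (map G (inserts x ys))) = int (Suc n) * sum G (tuples V (Suc n))"
proof (induction n arbitrary: G)
  case 0
  show ?case by (simp add: sum_tuples_Suc)
next
  case (Suc n)
  have "(\<Sum>x\<in>V. \<Sum>ys\<in>tuples V (Suc n). sum_list (map G (inserts x ys))) =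
      (\<Sum>x\<in>V. \<Sum>y\<in>V. \<Sum>ys\<in>tuples V n. G (x # y # ys)) +
      (\<Sum>x\<in>V. \<Sum>y\<in>V. \<Sum>ys\<in>tuples V n. sum_list (map (\<lambda>w. G (y # w)) (inserts x ys)))"
    by (simp add: sum_tuples_Suc sum.distrib comp_def)
  also have "(\<Sum>x\<in>V. \<Sum>y\<in>V. \<Sum>ys\<in>tuples V n. sum_list (map (\<lambda>w. G (y # w)) (inserts x ys))) =
      (\<Sum>y\<in>V. \<Sum>x\<in>V. \<Sum>ys\<in>tuples V n. sum_list (map (\<lambda>w. G (y # w)) (inserts x ys)))"
    by (rule sum.swap)
  also have "\<dots> = (\<Sum>y\<in>V. int (Suc n) * (\<Sum>w\<in>tuples V (Suc n). G (y # w)))"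
    by (simp only: Suc.IH)
  also have "\<dots> = int (Suc n) * sum G (tuples V (Suc (Suc n)))"
    by (simp add: sum_tuples_Suc sum_distrib_left)
  finally show ?case
    by (simp add: sum_tuples_Suc algebra_simps)
qed

text \<open>The set of tuples is closed under permuting positions, so symmetrising an integrand only
  multiplies its sum by n!.\<close>

lemma sum_perms:
  fixes G :: "'v list \<Rightarrow> int"
  shows "(\<Sum>xs\<in>tuples V n. sum_list (map G (perms xs))) = fact n * sum G (tuples V n)"
proof (induction n arbitrary: G)
  case (Suc n)
  have *: "sum_list (map G (concat (map (inserts x) L))) = sum_list (map (\<lambda>w. sum_list (map G (inserts x w))) L)"
    for x and L by (induction L) simp_all
  have "(\<Sum>xs\<in>tuples V (Suc n). sum_list (map G (perms xs))) =
      (\<Sum>x\<in>V. fact n * (\<Sum>xs\<in>tuples V n. sum_list (map G (inserts x xs))))"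
    by (simp add: sum_tuples_Suc * Suc.IH)
  also have "\<dots> = fact n * (int (Suc n) * sum G (tuples V (Suc n)))"
    by (simp only: sum_inserts flip: sum_distrib_left)
  finally show ?case by (simp add: algebra_simps)
qed simp

definition sum5 :: "'v set \<Rightarrow> ('v \<Rightarrow> 'v \<Rightarrow> 'v \<Rightarrow> 'v \<Rightarrow> 'v \<Rightarrow> int) \<Rightarrow> int" where
  "sum5 V F = (\<Sum>a\<in>V. \<Sum>b\<in>V. \<Sum>c\<in>V. \<Sum>d\<in>V. \<Sum>e\<in>V. F a b c d e)"

lemma sum_sum120: "(\<Sum>xs\<in>tuples V 5. sum120 F xs) = 120 * sum5 V F"
proof -
  have "sum (on5 F) (tuples V 5) = sum5 V F"
    by (simp add: sum5_def eval_nat_numeral sum_tuples_Suc)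
  moreover have "fact 5 = (120 :: int)"
    by (simp add: eval_nat_numeral)
  ultimately show ?thesis
    using sum_perms[of "on5 F" V 5] by (simp add: sum120_def)
qed

section \<open>From vertex tuples to sorted patterns\<close>

lemma perms_map: "perms (map g xs) = map (map g) (perms xs)"
proof (induction xs)
  case (Cons x xs)
  have *: "inserts (g y) (map g ys) = map (map g) (inserts y ys)" for y ys
    by (induction ys) simp_all
  show ?case by (simp add: Cons.IH map_concat comp_def *)
qed simp

lemma on5_map: "on5 F (map g xs) = on5 (\<lambda>a b c d e. F (g a) (g b) (g c) (g d) (g e)) xs"
  by (induction "\<lambda>a b c d e. F (g a) (g b) (g c) (g d) (g e)" xs rule: on5.induct) simp_all

text \<open>The certificate sees only the coloured graph pulled back along \<open>g\<close>.
  Injectivity is not assumed, which is how tuples with repeated vertices become ordinary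
  patterns.\<close>

lemma cert_map: "cert A h (map g xs) = cert (\<lambda>u v. A (g u) (g v)) (\<lambda>u. h (g u)) xs"
  by (simp add: cert_def sum120_def perms_map comp_def on5_map
      high_term_def[abs_def] low_term_def[abs_def] sq3_def[abs_def] sq3_at_def sq2_def[abs_def] sq1_def[abs_def])

lemma ascending_iff: "ascending xs \<longleftrightarrow> sorted xs"
  by (induction xs rule: ascending.induct) (auto simp: order_trans)

lemma deg_in_bounds: "0 \<le> deg_in A xs v" "deg_in A xs v \<le> int (length xs)"
  unfolding deg_in_def by (induction xs) (auto simp: ind_def)

lemma key_bounds:
  assumes "length xs = 5"
  shows "h v \<Longrightarrow> 1000 \<le> key A h xs v" "\<not> h v \<Longrightarrow> key A h xs v < 1000"
proof -
  have "0 \<le> sum_list (map (\<lambda>u. ite (A v u) (20 + deg_in A xs u) 0) ys)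
      \<and> sum_list (map (\<lambda>u. ite (A v u) (20 + deg_in A xs u) 0) ys) \<le> 25 * int (length ys)" for ys
  proof (induction ys)
    case (Cons y ys)
    then show ?case
      using deg_in_bounds[of A xs y] assms by simp
  qed simp
  from this[of xs] show "h v \<Longrightarrow> 1000 \<le> key A h xs v" "\<not> h v \<Longrightarrow> key A h xs v < 1000"
    using assms by (auto simp: key_def)
qed

text \<open>The key refers to the very list that it sorts; this invariance lets the keys of the
  sorted list be used instead.\<close>

lemma key_cong_mset:
  assumes "mset xs = mset ys"
  shows "key A h xs = key A h ys"
proof -
  have deg: "deg_in A xs = deg_in A ys"
    using assms by (simp add: deg_in_def fun_eq_iff flip: sum_mset_sum_list)
  show ?thesis
    using assms by (simp add: key_def fun_eq_iff deg cong: if_cong flip: sum_mset_sum_list)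
qed

lemma mem_both: "f \<in> set fs \<Longrightarrow> f b \<in> set (both fs)"
  by (cases b) (auto simp: both_def)

lemma mem_pats: "Pat a b c d e f g h i j \<in> set (pats a)"
  unfolding pats_def by (intro mem_both) simp

lemma fast_cert_nonpos:
  assumes "admissible h (adj p)" "h = last_high k" "k \<le> 5"
  shows "fast_cert (adj p) h vs \<le> 0"
proof -
  obtain a b c d e f g i j l where p: "p = Pat a b c d e f g i j l"
    by (cases p)
  have "k \<in> {0, 1, 2, 3, 4, 5}"
    using assms(3) by auto
  then have "list_all (pattern_ok (last_high k)) (pats a)"
    using pattern_ok_0_False pattern_ok_0_True pattern_ok_1_False pattern_ok_1_True
      pattern_ok_2_False pattern_ok_2_True pattern_ok_3_False pattern_ok_3_True
      pattern_ok_4_False pattern_ok_4_True pattern_ok_5_False pattern_ok_5_True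
    by (cases a) auto
  then have "pattern_ok h p"
    using mem_pats[of a b c d e f g i j l] assms(2) unfolding p list_all_iff by blast
  then show ?thesis
    using assms(1) by (simp add: pattern_ok_def)
qed

lemma cert_nonpos:
  assumes sym: "\<And>u v. A u v = A v u" and irrefl: "\<And>v. \<not> A v v"
    and free: "\<And>w x y z. \<lbrakk>w \<in> V; x \<in> V; y \<in> V; z \<in> V\<rbrakk> \<Longrightarrow> \<not> K4 A w x y z"
    and xs: "xs \<in> tuples V 5"
  shows "cert A h xs \<le> 0"
proof -
  define ys where "ys = sort_key (key A h xs) xs"
  have "length ys = 5" and ysV: "set ys \<subseteq> V"
    using xs by (simp_all add: ys_def tuples_def)
  then obtain a b c d e where ys: "ys = [a, b, c, d, e]"
    by (auto simp: eval_nat_numeral length_Suc_conv)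
  \<comment> \<open>Positions are sent to vertices. Equal vertices at different positions become
    non-adjacent ones, by irreflexivity.\<close>
  define g where "g = case_vtx a b c d e"
  have ys_map: "ys = map g vs"
    by (simp add: ys vs_def g_def)
  have key_ys: "key A h xs = key A h ys"
    by (rule key_cong_mset) (simp add: ys_def)
  have sorted: "sorted (map (key A h ys) ys)"
    unfolding key_ys[symmetric] by (simp add: ys_def)
  define p where "p = Pat (A a b) (A a c) (A b c) (A a d) (A b d) (A c d) (A a e) (A b e) (A c e) (A d e)"
  \<comment> \<open>In the sorted tuple the first high entry determines how many entries are
    high.\<close>
  define k :: nat where "k = (if h a then 5 else if h b then 4 else if h c then 3 else if h d then 2 else if h e then 1 else 0)"
  have adj: "(\<lambda>u v. A (g u) (g v)) = adj p"
  proof (intro ext)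
    fix u v
    show "A (g u) (g v) = adj p u v"
      by (cases u; cases v) (simp_all add: g_def p_def irrefl sym)
  qed
  have "key A h ys x \<le> key A h ys y \<Longrightarrow> h x \<Longrightarrow> h y" for x y
    using key_bounds[OF \<open>length ys = 5\<close>, of h _ A] by (meson not_le order.trans)
  then have mono: "h a \<longrightarrow> h b" "h b \<longrightarrow> h c" "h c \<longrightarrow> h d" "h d \<longrightarrow> h e"
    using sorted by (auto simp: ys)
  have last_high: "(\<lambda>v. h (g v)) = last_high k"
  proof
    fix v
    show "h (g v) = last_high k v"
      using mono by (cases v) (auto simp: g_def k_def)
  qed
  have "map (key A h ys) ys = map (key (adj p) (last_high k) vs) vs"
    unfolding adj[symmetric] last_high[symmetric] ys_map
    by (simp add: key_def deg_in_def comp_def cong: if_cong)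
  then have "ascending (map (key (adj p) (last_high k) vs) vs)"
    using sorted by (simp add: ascending_iff)
  \<comment> \<open>A K4 on positions would map to pairwise adjacent vertices of \<open>V\<close>,
    hence to a K4 of the graph.\<close>
  moreover have "\<not> K4 (adj p) u v w x" for u v w x
  proof -
    have "g y \<in> V" for y
      using ysV by (cases y) (simp_all add: ys g_def)
    then have "\<not> K4 A (g u) (g v) (g w) (g x)"
      using free by blast
    then show ?thesis
      unfolding adj[symmetric] by (simp add: K4_def)
  qed
  ultimately have "admissible (last_high k) (adj p)"
    by (simp add: admissible_def)
  then have "fast_cert (adj p) (last_high k) vs \<le> 0"
    by (rule fast_cert_nonpos[OF _ refl]) (simp add: k_def)
  moreover have "adj p u v = adj p v u" for u v
    unfolding adj[symmetric] by (rule sym)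
  then have "cert (adj p) (last_high k) vs = fast_cert (adj p) (last_high k) vs"
    unfolding vs_def by (rule cert_eq_fast_cert)
  moreover have "cert A h xs = cert (adj p) (last_high k) vs"
    using cert_sort[of A h "key A h xs" xs] cert_map[of A h g vs]
    by (simp add: ys_def[symmetric] ys_map adj last_high)
  ultimately show ?thesis by simp
qed

section \<open>Nonnegativity of the square terms\<close>

lemma sum5_sq3_nonneg: "0 \<le> sum5 V (sq3 A h)"
  unfolding sum5_def
proof (rule sum_nonneg, rule sum_nonneg, rule sum_nonneg)
  fix x y z
  show "0 \<le> (\<Sum>u\<in>V. \<Sum>v\<in>V. sq3 A h x y z u v)"
    by (cases "root3 (h x) (h y) (h z) (A x y) (A x z) (A y z) = R")
      (simp_all add: sq3_def sq3_at_def gram_eq sum_wdot_nonneg[OF weights_nonneg(1)])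
qed

text \<open>For fixed \<open>x\<close> and \<open>y\<close> the sum factors into the degree surplus
  of \<open>x\<close> and a positive semidefinite form \<open>Q\<close>; the hypothesis supplies the
  sign of the first factor.\<close>

lemma sum5_sq2_nonneg:
  assumes "\<And>x. x \<in> V \<Longrightarrow> h x \<Longrightarrow> 0 \<le> (\<Sum>z\<in>V. ite (A x z) 1 (-1 :: int))"
  shows "0 \<le> sum5 V (sq2 A h)"
  unfolding sum5_def
proof (rule sum_nonneg, rule sum_nonneg)
  fix x y
  assume "x \<in> V"
  define Q where "Q = (\<Sum>u\<in>V. \<Sum>v\<in>V.
     ite (h y) (gram_HH (ext2 (A x u) (A y u) (h u)) (ext2 (A x v) (A y v) (h v)))
       (gram_HL (ext2 (A x u) (A y u) (h u)) (ext2 (A x v) (A y v) (h v))))"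
  have "0 \<le> Q"
    by (cases "h y") (simp_all add: Q_def gram_eq sum_wdot_nonneg[OF weights_nonneg(2)]
        sum_wdot_nonneg[OF weights_nonneg(3)])
  moreover have "(\<Sum>z\<in>V. \<Sum>u\<in>V. \<Sum>v\<in>V. sq2 A h x y z u v) = (\<Sum>z\<in>V. ite (A x z) 1 (-1)) * Q"
    if "h x" "A x y"
    using that by (simp add: sq2_def Q_def sum_distrib_right flip: sum_distrib_left)
  moreover have "(\<Sum>z\<in>V. \<Sum>u\<in>V. \<Sum>v\<in>V. sq2 A h x y z u v) = 0" if "\<not> (h x \<and> A x y)"
    using that by (cases "h x") (simp_all add: sq2_def)
  ultimately show "0 \<le> (\<Sum>z\<in>V. \<Sum>u\<in>V. \<Sum>v\<in>V. sq2 A h x y z u v)"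
    using assms[OF \<open>x \<in> V\<close>] by (metis mult_nonneg_nonneg order_refl)
qed

text \<open>Over a fixed root the four other vertices form two independent pairs, so this is a
  quadratic form in flags indexed by \<open>V \<times> V\<close>.\<close>

lemma sum5_sq1_nonneg: "0 \<le> sum5 V (sq1 A h)"
  unfolding sum5_def
proof (rule sum_nonneg)
  fix x
  let ?L = "\<lambda>(u, v). forms_L (ext1 (A x u) (A x v) (A u v) (h u) (h v))"
  have "0 \<le> (\<Sum>p\<in>V \<times> V. \<Sum>q\<in>V \<times> V. wdot weights_L (?L p) (?L q))"
    by (rule sum_wdot_nonneg[OF weights_nonneg(4)])
  also have "\<dots> = (\<Sum>u\<in>V. \<Sum>v\<in>V. \<Sum>w\<in>V. \<Sum>z\<in>V.
      gram_L (ext1 (A x u) (A x v) (A u v) (h u) (h v)) (ext1 (A x w) (A x z) (A w z) (h w) (h z)))"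
    by (simp add: gram_eq sum.cartesian_product')
  finally show "0 \<le> (\<Sum>u\<in>V. \<Sum>v\<in>V. \<Sum>w\<in>V. \<Sum>z\<in>V. sq1 A h x u v w z)"
    by (cases "h x") (simp_all add: sq1_def)
qed

text \<open>Summed over all tuples, the certificate is nonpositive termwise, and it is 120 times the
  two test sums plus nonnegative squares. Dropping the squares leaves a bound opposite to the one
  from the test vectors.\<close>

lemma high_low_nonpos:
  assumes "\<And>u v. A u v = A v u" "\<And>v. \<not> A v v"
    and "\<And>w x y z. \<lbrakk>w \<in> V; x \<in> V; y \<in> V; z \<in> V\<rbrakk> \<Longrightarrow> \<not> K4 A w x y z"
    and "\<And>x. x \<in> V \<Longrightarrow> h x \<Longrightarrow> 0 \<le> (\<Sum>z\<in>V. ite (A x z) 1 (-1 :: int))"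
  shows "high_weight * sum5 V (high_term A h) + low_weight * sum5 V (low_term A h) \<le> 0"
proof -
  define hl where "hl = high_weight * sum5 V (high_term A h) + low_weight * sum5 V (low_term A h)"
  have sq2: "0 \<le> sum5 V (sq2 A h)"
    by (rule sum5_sq2_nonneg) (rule assms(4))
  have "120 * (hl + sum5 V (sq3 A h) + sum5 V (sq2 A h) + sum5 V (sq1 A h)) = (\<Sum>xs\<in>tuples V 5. cert A h xs)"
    unfolding cert_def sum.distrib hl_def by (simp add: sum_sum120 algebra_simps flip: sum_distrib_left)
  also have "\<dots> \<le> 0"
    using cert_nonpos[of A V _ h] assms(1-3) by (intro sum_nonpos) blast
  finally have "hl + (sum5 V (sq3 A h) + sum5 V (sq2 A h) + sum5 V (sq1 A h)) \<le> 0"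
    by (simp add: add.assoc)
  moreover have "0 \<le> sum5 V (sq3 A h) + sum5 V (sq2 A h) + sum5 V (sq1 A h)"
    using sq2 by (intro add_nonneg_nonneg sum5_sq3_nonneg sum5_sq1_nonneg)
  ultimately have "hl \<le> 0"
    by (rule le_add_same_cancel1[THEN iffD2, THEN order.trans, rotated])
  then show ?thesis
    by (simp add: hl_def)
qed

section \<open>The contradiction\<close>

context no_good_cut
begin

definition high :: "'v \<Rightarrow> bool" where
  "high x \<longleftrightarrow> n / 2 < deg x"

lemma sum4_product:
  fixes F :: "'v \<Rightarrow> 'v \<Rightarrow> real"
  shows "(\<Sum>u\<in>V. \<Sum>v\<in>V. \<Sum>w\<in>V. \<Sum>z\<in>V. F u v * (f w * g z)) = (\<Sum>u\<in>V. \<Sum>v\<in>V. F u v) * (sum f V * sum g V)"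
proof -
  have "(\<Sum>w\<in>V. \<Sum>z\<in>V. F u v * (f w * g z)) = F u v * (sum f V * sum g V)" for u v
    unfolding sum_product by (simp only: sum_distrib_left)
  then show ?thesis
    by (simp only: sum_distrib_right)
qed

lemma real_ind: "real_of_int (ind (A u v)) = a u v"
  by (simp add: ind_def a_def)

lemma form_a: "form V A f g = (\<Sum>u\<in>V. \<Sum>v\<in>V. a u v * f u * g v)"
  by (simp add: form_def a_def)

lemma sum_one: "(\<Sum>v\<in>V. 1) = n"
  by (simp add: n(1))

lemma real_low_sum:
  assumes "\<not> high x"
  shows "real_of_int (\<Sum>u\<in>V. \<Sum>v\<in>V. \<Sum>w\<in>V. \<Sum>z\<in>V. low_term A high x u v w z) =
    (9 * m - 4 * n\<^sup>2) * (n - deg x)\<^sup>2 + 9 * n\<^sup>2 * T x - 18 * n * deg x * D x + 9 * (deg x)\<^sup>2 * m"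
proof -
  \<comment> \<open>The inserted factors 1 give every summand the product shape of
    \<open>sum4_product\<close>; summing such a factor yields n.\<close>
  have "real_of_int (\<Sum>u\<in>V. \<Sum>v\<in>V. \<Sum>w\<in>V. \<Sum>z\<in>V. low_term A high x u v w z) =
    (\<Sum>u\<in>V. \<Sum>v\<in>V. \<Sum>w\<in>V. \<Sum>z\<in>V. (9 * a u v - 4) * ((1 - a x w) * (1 - a x z))
       + (9 * (a u v * a x u * a x v)) * (1 * 1) - (18 * (a u v * a x u)) * (a x w * 1) + (9 * a u v) * (a x w * a x z))"
    using assms by (simp add: low_term_def real_ind mult_ac)
  also have "\<dots> = (\<Sum>u\<in>V. \<Sum>v\<in>V. 9 * a u v - 4) * ((\<Sum>w\<in>V. 1 - a x w) * (\<Sum>z\<in>V. 1 - a x z))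
      + 9 * T x * (n * n) - 18 * D x * (deg x * n) + 9 * m * (deg x * deg x)"
  proof -
    have "(\<Sum>u\<in>V. \<Sum>v\<in>V. 9 * (a u v * a x u * a x v)) = 9 * T x"
      "(\<Sum>u\<in>V. \<Sum>v\<in>V. 18 * (a u v * a x u)) = 18 * D x" "(\<Sum>u\<in>V. \<Sum>v\<in>V. 9 * a u v) = 9 * m"
      by (simp_all add: T_def D_def m_def form_a sum_distrib_left)
    then show ?thesis
      unfolding sum.distrib sum_subtractf
      unfolding sum4_product deg_def[symmetric] sum_one by (simp add: sum_subtractf deg_def n(1))
  qed
  also have "(\<Sum>u\<in>V. \<Sum>v\<in>V. 9 * a u v - 4) = 9 * m - 4 * n\<^sup>2"
    by (simp add: m_def form_a sum_subtractf n(1) power2_eq_square flip: sum_distrib_left)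
  also have "(\<Sum>w\<in>V. 1 - a x w) = n - deg x"
    by (simp add: sum_subtractf deg_def n(1))
  finally show ?thesis
    by (simp add: power2_eq_square algebra_simps)
qed

lemma real_high_sum:
  assumes "high x" "high y" "A x y"
  defines "p \<equiv> \<lambda>v. a x v * a y v"
  shows "real_of_int (\<Sum>u\<in>V. \<Sum>v\<in>V. \<Sum>z\<in>V. high_term A high x y u v z) =
    sum p V * (18 * m - 4 * n\<^sup>2 - 36 * D x + 36 * T x) + 18 * (2 * deg x - n) * form V A p (\<lambda>v. 1 - 2 * a x v)"
proof -
  \<comment> \<open>\<open>G\<close> collects what multiplies the number of common neighbours; the
    factors 1 match the second argument of \<open>form\<close> in \<open>D x\<close>.\<close>
  define G where "G = (\<lambda>v z. 18 * a v z - 4 - 36 * (a v z * a x v * 1) + 36 * (a v z * a x v * a x z))"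
  have "real_of_int (\<Sum>u\<in>V. \<Sum>v\<in>V. \<Sum>z\<in>V. high_term A high x y u v z) =
    (\<Sum>u\<in>V. \<Sum>v\<in>V. \<Sum>z\<in>V. p u * G v z + 18 * ((a u v * p u * (1 - 2 * a x v)) * (2 * a x z - 1)))"
  proof -
    have "real_of_int (high_term A high x y u v z) =
        p u * G v z + 18 * ((a u v * p u * (1 - 2 * a x v)) * (2 * a x z - 1))" for u v z
      using assms(1-3) by (simp add: high_term_def real_ind p_def G_def) (auto simp: a_def)
    then show ?thesis by simp
  qed
  also have "\<dots> = (\<Sum>u\<in>V. p u * (\<Sum>v\<in>V. \<Sum>z\<in>V. G v z))
      + 18 * (form V A p (\<lambda>v. 1 - 2 * a x v) * (\<Sum>z\<in>V. 2 * a x z - 1))"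
    unfolding sum.distrib sum_distrib_left[symmetric] form_a sum_distrib_right ..
  also have "(\<Sum>v\<in>V. \<Sum>z\<in>V. G v z) = 18 * m - 4 * n\<^sup>2 - 36 * D x + 36 * T x"
    unfolding G_def sum.distrib sum_subtractf sum_distrib_left[symmetric]
    by (simp add: m_def D_def T_def form_a n(1) power2_eq_square)
  also have "(\<Sum>z\<in>V. 2 * a x z - 1) = 2 * deg x - n"
    by (simp add: sum_subtractf deg_def n(1) flip: sum_distrib_left)
  also have "(\<Sum>u\<in>V. p u * (18 * m - 4 * n\<^sup>2 - 36 * D x + 36 * T x)) = sum p V * (18 * m - 4 * n\<^sup>2 - 36 * D x + 36 * T x)"
    by (rule sum_distrib_right[symmetric])
  finally show ?thesis
    by (simp only: mult_ac)
qed

lemma high_sum_nonneg: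
  assumes "x \<in> V" "y \<in> V"
  shows "0 \<le> (\<Sum>u\<in>V. \<Sum>v\<in>V. \<Sum>z\<in>V. high_term A high x y u v z)"
    and "high x \<Longrightarrow> high y \<Longrightarrow> A x y \<Longrightarrow> 0 < (\<Sum>u\<in>V. \<Sum>v\<in>V. \<Sum>z\<in>V. high_term A high x y u v z)"
proof -
  show pos: "0 < (\<Sum>u\<in>V. \<Sum>v\<in>V. \<Sum>z\<in>V. high_term A high x y u v z)" if "high x" "high y" "A x y"
    using high_pos[OF assms that(3)] that(1,2) unfolding real_high_sum[OF that, symmetric] of_int_0_less_iff
    by (simp add: high_def)
  show "0 \<le> (\<Sum>u\<in>V. \<Sum>v\<in>V. \<Sum>z\<in>V. high_term A high x y u v z)"
  proof (cases "high x \<and> high y \<and> A x y")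
    case False
    then have "high_term A high x y u v z = 0" for u v z
      by (auto simp: high_term_def)
    then show ?thesis by simp
  qed (use pos in auto)
qed

lemma low_sum_nonneg:
  assumes "x \<in> V"
  shows "0 \<le> (\<Sum>u\<in>V. \<Sum>v\<in>V. \<Sum>w\<in>V. \<Sum>z\<in>V. low_term A high x u v w z)"
    and "\<not> high x \<Longrightarrow> 0 < (\<Sum>u\<in>V. \<Sum>v\<in>V. \<Sum>w\<in>V. \<Sum>z\<in>V. low_term A high x u v w z)"
proof -
  show pos: "0 < (\<Sum>u\<in>V. \<Sum>v\<in>V. \<Sum>w\<in>V. \<Sum>z\<in>V. low_term A high x u v w z)" if "\<not> high x"
    using low_pos[OF assms] that unfolding real_low_sum[OF that, symmetric] of_int_0_less_iff
    by (simp add: high_def)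
  show "0 \<le> (\<Sum>u\<in>V. \<Sum>v\<in>V. \<Sum>w\<in>V. \<Sum>z\<in>V. low_term A high x u v w z)"
    using pos by (cases "high x") (auto simp: low_term_def)
qed

text \<open>The combination is nonpositive while both test sums are nonnegative with positive
  multipliers. It remains to exhibit one strict test, and strictness is available because
  \<open>cut\<close> is strict.\<close>

lemma contradiction: False
proof -
  have "0 \<le> (\<Sum>z\<in>V. if A x z then 1 else - 1 :: int)" if "high x" for x
  proof -
    have "real_of_int (\<Sum>z\<in>V. if A x z then 1 else - 1) = (\<Sum>z\<in>V. 2 * a x z - 1)"
      unfolding of_int_sum by (intro sum.cong) (auto simp: a_def)
    also have "\<dots> = 2 * deg x - n"
      by (simp add: sum_subtractf deg_def n(1) flip: sum_distrib_left)
    finally have "0 \<le> real_of_int (\<Sum>z\<in>V. if A x z then 1 else - 1)"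
      using that by (simp only: high_def)
    then show ?thesis
      by (simp only: of_int_0_le_iff)
  qed
  moreover have "\<not> K4 A w x y z" if "w \<in> V" "x \<in> V" "y \<in> V" "z \<in> V" for w x y z
    using no_K4[OF that] by (auto simp: K4_def)
  ultimately have "high_weight * sum5 V (high_term A high) + low_weight * sum5 V (low_term A high) \<le> 0"
    using sym irrefl by (intro high_low_nonpos) auto
  moreover have hl: "0 \<le> sum5 V (high_term A high)" "0 \<le> sum5 V (low_term A high)"
    unfolding sum5_def
    by (rule sum_nonneg, rule sum_nonneg, rule high_sum_nonneg(1), assumption+)
      (rule sum_nonneg, rule low_sum_nonneg(1))
  \<comment> \<open>A low vertex gives a strict low test. If all vertices are high, degrees above
    n/2 > 0 force an edge, and both its ends are high.\<close>
  moreover have "0 < sum5 V (high_term A high) \<or> 0 < sum5 V (low_term A high)"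
  proof (cases "\<forall>x\<in>V. high x")
    case True
    obtain x where x: "x \<in> V"
      using n by fastforce
    obtain y where y: "y \<in> V" "A x y"
    proof (rule ccontr)
      assume "\<not> thesis"
      then have "deg x = 0"
        using that unfolding deg_def by (intro sum.neutral) (auto simp: a_def)
      then show False
        using True x n(2) by (auto simp: high_def)
    qed
    have y_pos: "0 < (\<Sum>u\<in>V. \<Sum>v\<in>V. \<Sum>z\<in>V. high_term A high x y u v z)"
      using True x y by (intro high_sum_nonneg(2)) blast+
    have x_pos: "0 < (\<Sum>y\<in>V. \<Sum>u\<in>V. \<Sum>v\<in>V. \<Sum>z\<in>V. high_term A high x y u v z)"
      by (rule sum_pos2[OF finite y(1)], rule y_pos, rule high_sum_nonneg(1)[OF x])
    have "0 < sum5 V (high_term A high)"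
      unfolding sum5_def
      by (rule sum_pos2[OF finite x], rule x_pos, rule sum_nonneg, rule high_sum_nonneg(1))
    then show ?thesis ..
  next
    case False
    then obtain x where x: "x \<in> V" "\<not> high x" by blast
    have "0 < sum5 V (low_term A high)"
      unfolding sum5_def
      by (rule sum_pos2[OF finite x(1)], rule low_sum_nonneg(2)[OF x], rule low_sum_nonneg(1))
    then show ?thesis ..
  qed
  ultimately show False
    by (simp add: high_weight_def low_weight_def)
qed

end

section \<open>Translation between edge sets and quadratic forms\<close>

text \<open>The ordered pairs are grouped by the edge they span; \<open>Q e\<close> is the fibre
  over \<open>e\<close>, which has two elements because edges have two distinct ends.\<close>

lemma card_ordered_edges:
  assumes "simple_graph V E" "X \<subseteq> V"
  shows "(\<Sum>u\<in>X. \<Sum>v\<in>X. of_bool ({u, v} \<in> E) :: real) = 2 * real (induced_edges E X)"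
proof -
  define F where "F = {e \<in> E. e \<subseteq> X}"
  define Q where "Q = (\<lambda>e. {p. {fst p, snd p} = (e :: 'a set)})"
  have X: "finite X"
    using assms finite_subset by (auto simp: simple_graph_def)
  have F: "finite F"
    by (rule finite_subset[of _ "Pow X"]) (auto simp: F_def X)
  have Q: "finite (Q e) \<and> card (Q e) = 2" if "e \<in> F" for e
  proof -
    have "card e = 2"
      using that assms(1) by (simp add: F_def simple_graph_def)
    then obtain x y where "e = {x, y}" "x \<noteq> y"
      by (auto simp: card_2_iff)
    then have "Q e = {(x, y), (y, x)}"
      by (auto simp: Q_def doubleton_eq_iff)
    then show ?thesis
      using \<open>x \<noteq> y\<close> by simp
  qed
  have "(\<Sum>u\<in>X. \<Sum>v\<in>X. of_bool ({u, v} \<in> E) :: real) = (\<Sum>p\<in>X \<times> X. if p \<in> (\<Union>e\<in>F. Q e) then 1 else 0)"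
    by (auto simp: sum.cartesian_product F_def Q_def intro!: sum.cong)
  also have "\<dots> = real (card (\<Union>e\<in>F. Q e))"
  proof -
    have "X \<times> X \<inter> {p. p \<in> (\<Union>e\<in>F. Q e)} = (\<Union>e\<in>F. Q e)"
      by (auto simp: F_def Q_def)
    then show ?thesis
      using X by (simp only: sum.If_cases finite_cartesian_product) simp
  qed
  also have "card (\<Union>e\<in>F. Q e) = (\<Sum>e\<in>F. card (Q e))"
    using F Q by (intro card_UN_disjoint) (auto simp: Q_def)
  also have "\<dots> = 2 * card F"
    using Q by simp
  finally show ?thesis
    by (simp add: induced_edges_def F_def)
qed

text \<open>The factor 1 + s_u s_v is 2 for a pair on one side and 0 across. Counting ordered pairs
  doubles once more.\<close>

lemma form_sign_eq:
  assumes G: "simple_graph V E" and X: "X \<subseteq> V"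
  shows "form V (\<lambda>u v. {u, v} \<in> E) (\<lambda>_. 1) (\<lambda>_. 1) + form V (\<lambda>u v. {u, v} \<in> E) (sign X) (sign X) =
    4 * real (induced_edges E X + induced_edges E (V - X))"
proof -
  have V: "finite V"
    using G by (simp add: simple_graph_def)
  let ?a = "\<lambda>u v. of_bool ({u, v} \<in> E) :: real"
  have restrict: "(\<Sum>u\<in>V. \<Sum>v\<in>V. if u \<in> Y \<and> v \<in> Y then ?a u v else 0) = (\<Sum>u\<in>Y. \<Sum>v\<in>Y. ?a u v)"
    if "Y \<subseteq> V" for Y
  proof -
    have "(\<Sum>u\<in>V. \<Sum>v\<in>V. if u \<in> Y \<and> v \<in> Y then ?a u v else 0) =
        (\<Sum>p\<in>V \<times> V. if p \<in> Y \<times> Y then ?a (fst p) (snd p) else 0)"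
      by (simp add: sum.cartesian_product case_prod_unfold mem_Times_iff)
    also have "\<dots> = (\<Sum>p\<in>Y \<times> Y. ?a (fst p) (snd p))"
      using V that by (simp add: sum.inter_restrict[symmetric] Int_absorb1 Sigma_mono)
    finally show ?thesis
      by (simp add: sum.cartesian_product case_prod_unfold)
  qed
  have "form V (\<lambda>u v. {u, v} \<in> E) (\<lambda>_. 1) (\<lambda>_. 1) + form V (\<lambda>u v. {u, v} \<in> E) (sign X) (sign X) =
      (\<Sum>u\<in>V. \<Sum>v\<in>V. 2 * (if u \<in> X \<and> v \<in> X then ?a u v else 0)
        + 2 * (if u \<in> V - X \<and> v \<in> V - X then ?a u v else 0))"
    unfolding form_def sum.distrib[symmetric] by (intro sum.cong refl) (auto simp: sign_def)
  also have "\<dots> = 2 * (\<Sum>u\<in>X. \<Sum>v\<in>X. ?a u v) + 2 * (\<Sum>u\<in>V - X. \<Sum>v\<in>V - X. ?a u v)"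
    unfolding sum.distrib sum_distrib_left[symmetric] restrict[OF X] restrict[OF Diff_subset] ..
  finally show ?thesis
    by (simp add: card_ordered_edges[OF G X] card_ordered_edges[OF G Diff_subset])
qed

theorem mainTheorem1:
  fixes V :: "'a set" and E :: "'a set set" and n :: nat
  assumes "simple_graph V E" and "K4_free V E"
    and "card V = n" and "n > 0"
  shows "\<exists>A B. A \<union> B = V \<and> A \<inter> B = {} \<and> card A = n div 2 \<and> card B = n - n div 2 \<and>
           real (induced_edges E A + induced_edges E B) \<le> real n ^ 2 / 9"
proof (rule ccontr)
  assume "\<not> ?thesis"
  then have no_cut: "\<not> real (induced_edges E A + induced_edges E B) \<le> real n ^ 2 / 9"
    if "A \<union> B = V" "A \<inter> B = {}" "card A = n div 2" "card B = n - n div 2" for A B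
    using that by blast
  let ?A = "\<lambda>u v. {u, v} \<in> E"
  have V: "finite V"
    using assms(1) by (simp add: simple_graph_def)
  have sym: "?A u v = ?A v u" for u v
    by (simp add: insert_commute)
  have irrefl: "\<not> ?A v v" for v
    using assms(1) by (auto simp: simple_graph_def)
  interpret no_good_cut V ?A "real n"
  proof
    show "finite V" "real n = real (card V)" "0 < real n"
      using V assms(3,4) by simp_all
    show "?A u v = ?A v u" "\<not> ?A v v" for u v
      by (rule sym, rule irrefl)
  next
    fix w x y z
    assume "w \<in> V" "x \<in> V" "y \<in> V" "z \<in> V" and adj: "?A w x" "?A w y" "?A w z" "?A x y" "?A x z" "?A y z"
    have "w \<noteq> x" "w \<noteq> y" "w \<noteq> z" "x \<noteq> y" "x \<noteq> z" "y \<noteq> z"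
      using adj irrefl by blast+
    then have "card {w, x, y, z} = 4"
      by simp
    moreover have "?A x w" "?A y w" "?A z w" "?A y x" "?A z x" "?A z y"
      using adj by (simp_all only: insert_commute)
    then have "\<forall>u\<in>{w, x, y, z}. \<forall>v\<in>{w, x, y, z}. u \<noteq> v \<longrightarrow> {u, v} \<in> E"
      using adj by simp
    moreover have "{w, x, y, z} \<subseteq> V"
      using \<open>w \<in> V\<close> \<open>x \<in> V\<close> \<open>y \<in> V\<close> \<open>z \<in> V\<close> by simp
    ultimately have "\<exists>K. K \<subseteq> V \<and> card K = 4 \<and> (\<forall>u\<in>K. \<forall>v\<in>K. u \<noteq> v \<longrightarrow> {u, v} \<in> E)"
      by (intro exI[of _ "{w, x, y, z}"] conjI)
    then show False
      using assms(2) by (simp only: K4_free_def not_True_eq_False)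
  next
    fix s assume "balanced V s"
    \<comment> \<open>Rounding yields an honest cut with floor(n/2) vertices in \<open>X\<close>;
      the assumed failure for that cut passes back to \<open>s\<close>.\<close>
    then obtain X where X: "X \<subseteq> V" "card X = card V div 2" "form V ?A (sign X) (sign X) \<le> form V ?A s s"
      using balanced_rounding[of V ?A, OF V sym irrefl] by blast
    have "card (V - X) = n - n div 2"
      using X assms(3) V by (simp add: card_Diff_subset finite_subset)
    then have "\<not> real (induced_edges E X + induced_edges E (V - X)) \<le> real n ^ 2 / 9"
      using X assms(3) by (intro no_cut) auto
    then show "4 / 9 * (real n)\<^sup>2 < form V ?A (\<lambda>_. 1) (\<lambda>_. 1) + form V ?A s s"
      using form_sign_eq[OF assms(1) X(1)] X(3) by simp
  qed
  show False
    by (rule contradiction)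
qed

end
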